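(* Deciding whether the avatar can reach the exit location in a game that features 2-buttons and doors (defined below) is \textsf{PSPACE}-hard.
   Context: A game level consists of a finite set of locations with an adjacency relation along which a single avatar moves (one step at a time to an adjacent location), a start location and an exit location. Some locations are \emph{doors}; each door is at any time either open or closed (with a given initial state), and the avatar may enter a door location only if the door is open. Some locations contain \emph{buttons}. A $k$-button is associated with up to $k$ doors and, for each of them, an action ``open'' or ``close''; when the avatar is at the button's location it may choose to press the button, which performs all its actions (setting each associated door to open or closed respectively). A 2-button is a $k$-button with $k=2$. The problem: given such a level (in which the only special elements are doors and 2-buttons), can the avatar reach the exit location from the start location? *)

theory Defs
  imports "HOL-Computational_Algebra.Polynomial"
begin

text \<open>
  Deterministic Turing machines with finitely many two-way infinite tapes. States and tape symbols
  are initial segments of the natural numbers. State 0 is initial, 1 accepts, 2 rejects, and the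
  machine halts in the latter two. Symbol 0 is the blank; symbols 1 and 2 stand for the input bits
  False and True. A transition maps the current state and the scanned symbols to the next state and,
  for every tape, the symbol to be written and the head displacement.
\<close>

record tm =
  num_tapes :: nat
  num_states :: nat
  num_syms :: nat
  delta :: "nat \<Rightarrow> nat list \<Rightarrow> nat \<times> (nat \<times> int) list"

definition wf_tm :: "tm \<Rightarrow> bool" where
  "wf_tm M \<longleftrightarrow>
     num_tapes M \<ge> 1 \<and> num_states M \<ge> 3 \<and> num_syms M \<ge> 3 \<and>
     (\<forall>q ss. q < num_states M \<and> length ss = num_tapes M \<and> (\<forall>s\<in>set ss. s < num_syms M) \<longrightarrow>
        (case delta M q ss of (q', as) \<Rightarrow>
           q' < num_states M \<and> length as = num_tapes M \<and>
           (\<forall>(w, d)\<in>set as. w < num_syms M \<and> d \<in> {-1, 0, 1})))"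

type_synonym tape = "(int \<Rightarrow> nat) \<times> int"
type_synonym tm_config = "nat \<times> tape list"

definition halted :: "tm_config \<Rightarrow> bool" where
  "halted c \<longleftrightarrow> fst c \<in> {1, 2}"

definition tm_step :: "tm \<Rightarrow> tm_config \<Rightarrow> tm_config" where
  "tm_step M c =
     (if halted c then c
      else case c of (q, ts) \<Rightarrow>
        (case delta M q (map (\<lambda>(t, h). t h) ts) of (q', as) \<Rightarrow>
           (q', map2 (\<lambda>(w, d) (t, h). (t(h := w), h + d)) as ts)))"

definition tape_of :: "bool list \<Rightarrow> int \<Rightarrow> nat" where
  "tape_of x i = (if 0 \<le> i \<and> i < int (length x) then (if x ! nat i then 2 else 1) else 0)"

definition tm_init :: "tm \<Rightarrow> bool list \<Rightarrow> tm_config" where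
  "tm_init M x = (0, (tape_of x, 0) # replicate (num_tapes M - 1) (tape_of [], 0))"

definition tm_run :: "tm \<Rightarrow> bool list \<Rightarrow> nat \<Rightarrow> tm_config" where
  "tm_run M x t = (tm_step M ^^ t) (tm_init M x)"

text \<open>
  Languages are sets of bit strings. PSPACE is defined with single-tape machines, as usual; every
  head position must stay within polynomial distance of the origin. Functions are computed by
  multi-tape machines, with the input on the first tape and the output alone on the last tape.
\<close>

definition PSPACE :: "bool list set set" where
  "PSPACE = {A. \<exists>M (p :: nat poly). wf_tm M \<and> num_tapes M = 1 \<and>
     (\<forall>x. (\<forall>t. \<forall>(_, h)\<in>set (snd (tm_run M x t)). \<bar>h\<bar> \<le> int (poly p (length x))) \<and>
          (\<exists>t. fst (tm_run M x t) = (if x \<in> A then 1 else 2)))}"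

definition polytime_computable :: "(bool list \<Rightarrow> bool list) \<Rightarrow> bool" where
  "polytime_computable f \<longleftrightarrow> (\<exists>M (p :: nat poly). wf_tm M \<and>
     (\<forall>x. \<exists>t \<le> poly p (length x).
        halted (tm_run M x t) \<and> fst (last (snd (tm_run M x t))) = tape_of (f x)))"

definition polytime_reducible :: "bool list set \<Rightarrow> bool list set \<Rightarrow> bool" where
  "polytime_reducible A B \<longleftrightarrow> (\<exists>f. polytime_computable f \<and> (\<forall>x. x \<in> A \<longleftrightarrow> f x \<in> B))"

definition PSPACE_hard :: "bool list set \<Rightarrow> bool" where
  "PSPACE_hard B \<longleftrightarrow> (\<forall>A\<in>PSPACE. polytime_reducible A B)"

text \<open>
  The locations are the numbers below \<open>num_locs\<close>, and doors are identified with their locations.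
  The Boolean attached to a door tells whether it is initially open. A button is given by its
  location and its actions, a list of doors each with the Boolean True for ``open'' and False for
  ``close''.
\<close>

record level =
  num_locs :: nat
  edges :: "(nat \<times> nat) list"
  start_loc :: nat
  exit_loc :: nat
  doors :: "(nat \<times> bool) list"
  buttons :: "(nat \<times> (nat \<times> bool) list) list"

definition door_locs :: "level \<Rightarrow> nat set" where
  "door_locs L = fst ` set (doors L)"

definition wf_level :: "nat \<Rightarrow> level \<Rightarrow> bool" where
  "wf_level k L \<longleftrightarrow>
     (\<forall>(u, v)\<in>set (edges L). u < num_locs L \<and> v < num_locs L) \<and>
     start_loc L < num_locs L \<and> exit_loc L < num_locs L \<and>
     distinct (map fst (doors L)) \<and> (\<forall>d\<in>door_locs L. d < num_locs L) \<and>
     distinct (map fst (buttons L)) \<and>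
     (\<forall>(b, acts)\<in>set (buttons L). b < num_locs L \<and> length acts \<le> k \<and>
        distinct (map fst acts) \<and> fst ` set acts \<subseteq> door_locs L)"

definition adjacent :: "level \<Rightarrow> nat \<Rightarrow> nat \<Rightarrow> bool" where
  "adjacent L u v \<longleftrightarrow> (u, v) \<in> set (edges L) \<or> (v, u) \<in> set (edges L)"

definition press :: "(nat \<times> bool) list \<Rightarrow> nat set \<Rightarrow> nat set" where
  "press acts D = (D - {d. (d, False) \<in> set acts}) \<union> {d. (d, True) \<in> set acts}"

text \<open>A game state is the position of the avatar together with the set of open doors.\<close>

inductive level_step :: "level \<Rightarrow> nat \<times> nat set \<Rightarrow> nat \<times> nat set \<Rightarrow> bool" for L where
  move: "adjacent L u v \<Longrightarrow> v \<in> door_locs L \<longrightarrow> v \<in> D \<Longrightarrow> level_step L (u, D) (v, D)"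
| press: "(u, acts) \<in> set (buttons L) \<Longrightarrow> level_step L (u, D) (u, press acts D)"

definition exit_reachable :: "level \<Rightarrow> bool" where
  "exit_reachable L \<longleftrightarrow>
     (\<exists>D. (level_step L)\<^sup>*\<^sup>* (start_loc L, {d. (d, True) \<in> set (doors L)}) (exit_loc L, D))"

text \<open>
  Numbers are written in unary. As all numbers occurring in a well-formed level are at most the
  number of locations, this changes the length of encodings only polynomially compared to binary
  notation together with an explicit list of the locations.
\<close>

definition enc_nat :: "nat \<Rightarrow> bool list" where
  "enc_nat n = replicate n True @ [False]"

definition enc_pair :: "('a \<Rightarrow> bool list) \<Rightarrow> ('b \<Rightarrow> bool list) \<Rightarrow> 'a \<times> 'b \<Rightarrow> bool list" where
  "enc_pair e f p = e (fst p) @ f (snd p)"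

definition enc_list :: "('a \<Rightarrow> bool list) \<Rightarrow> 'a list \<Rightarrow> bool list" where
  "enc_list e xs = concat (map (\<lambda>x. True # e x) xs) @ [False]"

definition enc_bool :: "bool \<Rightarrow> bool list" where
  "enc_bool b = [b]"

definition enc_level :: "level \<Rightarrow> bool list" where
  "enc_level L =
     enc_nat (num_locs L) @
     enc_list (enc_pair enc_nat enc_nat) (edges L) @
     enc_nat (start_loc L) @
     enc_nat (exit_loc L) @
     enc_list (enc_pair enc_nat enc_bool) (doors L) @
     enc_list (enc_pair enc_nat (enc_list (enc_pair enc_nat enc_bool))) (buttons L)"

definition prefix_code :: "('a \<Rightarrow> bool list) \<Rightarrow> bool" where
  "prefix_code e \<longleftrightarrow> (\<forall>x y r s. e x @ r = e y @ s \<longrightarrow> x = y \<and> r = s)"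

lemma prefix_codeD: "prefix_code e \<Longrightarrow> e x @ r = e y @ s \<Longrightarrow> x = y \<and> r = s"
  unfolding prefix_code_def by blast

lemma prefix_code_nat: "prefix_code enc_nat"
proof -
  have "x = y \<and> r = s" if "enc_nat x @ r = enc_nat y @ s" for x y r s
    using that
  proof (induction x arbitrary: y)
    case 0
    then show ?case by (cases y) (auto simp: enc_nat_def)
  next
    case (Suc x)
    then show ?case by (cases y) (auto simp: enc_nat_def)
  qed
  then show ?thesis unfolding prefix_code_def by blast
qed

lemma prefix_code_bool: "prefix_code enc_bool"
  by (auto simp: prefix_code_def enc_bool_def)

lemma prefix_code_pair:
  assumes "prefix_code e" "prefix_code f"
  shows "prefix_code (enc_pair e f)"
  unfolding prefix_code_def enc_pair_def
  by (metis append_assoc assms prefix_codeD prod.expand)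

lemma prefix_code_list:
  assumes "prefix_code e"
  shows "prefix_code (enc_list e)"
proof -
  have "xs = ys \<and> r = s" if "enc_list e xs @ r = enc_list e ys @ s" for xs ys r s
    using that
  proof (induction xs arbitrary: ys)
    case Nil
    then show ?case by (cases ys) (auto simp: enc_list_def)
  next
    case (Cons x xs)
    then obtain y ys' where ys: "ys = y # ys'"
      by (cases ys) (auto simp: enc_list_def)
    have "e x @ enc_list e xs @ r = e y @ enc_list e ys' @ s"
      using Cons.prems ys by (simp add: enc_list_def)
    then have "x = y" "enc_list e xs @ r = enc_list e ys' @ s"
      using prefix_codeD[OF assms] by blast+
    then show ?case using Cons.IH ys by blast
  qed
  then show ?thesis unfolding prefix_code_def by blast
qed

lemma inj_enc_level: "inj enc_level"
proof (rule injI)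
  fix L L' :: level
  note codes = prefix_code_nat prefix_code_bool prefix_code_pair prefix_code_list
  assume eq: "enc_level L = enc_level L'"
  show "L = L'"
  proof (rule level.equality)
    have E: "prefix_code (enc_list (enc_pair enc_nat enc_nat))"
      and D: "prefix_code (enc_list (enc_pair enc_nat enc_bool))"
      and B: "prefix_code (enc_list (enc_pair enc_nat (enc_list (enc_pair enc_nat enc_bool))))"
      by (intro codes)+
    note a = prefix_codeD[OF prefix_code_nat eq[unfolded enc_level_def]]
    note b = prefix_codeD[OF E conjunct2[OF a]]
    note c = prefix_codeD[OF prefix_code_nat conjunct2[OF b]]
    note d = prefix_codeD[OF prefix_code_nat conjunct2[OF c]]
    note e = prefix_codeD[OF D conjunct2[OF d]]
    have f: "buttons L = buttons L'"
      using prefix_codeD[OF B, of _ "[]" _ "[]"] conjunct2[OF e] by simp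
    show "num_locs L = num_locs L'" "edges L = edges L'" "start_loc L = start_loc L'"
      "exit_loc L = exit_loc L'" "doors L = doors L'" "buttons L = buttons L'"
      using a b c d e f by blast+
  qed simp
qed

definition button_game :: "nat \<Rightarrow> bool list set" where
  "button_game k = {enc_level L | L. wf_level k L \<and> exit_reachable L}"

end

theory Submission
  imports Defs
begin

text \<open>
  A single-tape Turing machine in polynomial space is turned into a row of cells, each in one of
  finitely many states, that are changed one at a time by rules of the form ``cell \<open>i\<close> may change
  from \<open>a\<close> to \<open>a'\<close> if its neighbour \<open>j\<close> is in state \<open>b\<close>''. In the level, a door for each pair of a
  cell and a state is open iff the cell is in that state, so a change of state is a single 2-button,
  and all positions are explored from a common hub. A door is a single location, and hence cannot
  guard several rules at once. Therefore each rule \<open>r\<close> has its own copy of the fact that cell \<open>j\<close> is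
  in state \<open>b\<close>: a pair of doors of which exactly one is open, where the copy can be switched on only
  if \<open>j\<close> is in state \<open>b\<close>. The change of a cell from state \<open>a\<close> is reached through a chain of doors
  witnessing that all copies of this state are switched off, and then through the copy of the rule.
  As cells are numbered uniformly and numbers are written in unary, the encoding of the level can be
  produced by nested loops over counters, which a multi-tape machine keeps as head positions.
\<close>

section \<open>Counter programs\<close>

text \<open>One change of state uses up both actions of a 2-button, so firing a rule cannot update
  any copy. Copies are therefore only required to be true while they are on; a copy that is off says
  nothing. The danger is a copy that stays on while its cell leaves the copied state, and the chain
  of doors in front of every change excludes this. Edges have no direction, so a gadget can also be
  entered from its far end, and soundness has to show that nothing is gained by it. A rule reads one
  neighbour and rewrites one cell, whereas a head move rewrites two cells; the move is split into a
  handshake between sender and receiver in which each stage admits a single change. The reduction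
  itself must be computed by an explicit machine. All gadgets are translates of one gadget and
  location numbers are affine in the cell index, so apart from constants of the simulated machine
  the output depends only on the input bits, the input length and a polynomial of it. Counters with
  increment, decrement and zero test suffice to produce it.\<close>

type_synonym mstate = "int \<times> (nat \<Rightarrow> nat) \<times> bool list"

datatype op = Nop | Out bool | Inc nat | Dec nat | InL | InR

datatype cond = Nonzero nat | NonBlank | BitSet

fun apply_op :: "op \<Rightarrow> mstate \<Rightarrow> mstate" where
  "apply_op Nop s = s"
| "apply_op (Out b) (h, c, os) = (h, c, os @ [b])"
| "apply_op (Inc v) (h, c, os) = (h, c(v := Suc (c v)), os)"
| "apply_op (Dec v) (h, c, os) = (h, c(v := c v - 1), os)"
| "apply_op InL (h, c, os) = (h - 1, c, os)"
| "apply_op InR (h, c, os) = (h + 1, c, os)"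

fun holds :: "bool list \<Rightarrow> cond \<Rightarrow> mstate \<Rightarrow> bool" where
  "holds x (Nonzero v) (h, c, os) \<longleftrightarrow> c v \<noteq> 0"
| "holds x NonBlank (h, c, os) \<longleftrightarrow> tape_of x h \<noteq> 0"
| "holds x BitSet (h, c, os) \<longleftrightarrow> tape_of x h = 2"

datatype com = Basic op | Seq com com | If cond com com | While cond com

text \<open>The time index counts the instructions of the compiled code exactly: a true conditional
  pays for its test and for the jump over the other branch, a false one for the test alone, and each
  round of a loop for its test and the jump back.\<close>

inductive exec :: "bool list \<Rightarrow> com \<Rightarrow> mstate \<Rightarrow> nat \<Rightarrow> mstate \<Rightarrow> bool" for x where
  Basic: "exec x (Basic p) s 1 (apply_op p s)"
| Seq: "exec x c s t s' \<Longrightarrow> exec x d s' u s'' \<Longrightarrow> exec x (Seq c d) s (t + u) s''"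
| IfTrue: "holds x b s \<Longrightarrow> exec x c s t s' \<Longrightarrow> exec x (If b c d) s (t + 2) s'"
| IfFalse: "\<not> holds x b s \<Longrightarrow> exec x d s t s' \<Longrightarrow> exec x (If b c d) s (t + 1) s'"
| WhileFalse: "\<not> holds x b s \<Longrightarrow> exec x (While b c) s 1 s"
| WhileTrue: "holds x b s \<Longrightarrow> exec x c s t s' \<Longrightarrow> exec x (While b c) s' u s'' \<Longrightarrow>
    exec x (While b c) s (t + u + 2) s''"

section \<open>Compiling structured programs to jump code\<close>

datatype instr = Op op | Branch cond nat nat

fun com_size :: "com \<Rightarrow> nat" where
  "com_size (Basic p) = 1"
| "com_size (Seq c d) = com_size c + com_size d"
| "com_size (If b c d) = com_size c + com_size d + 2"
| "com_size (While b c) = com_size c + 2"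

text \<open>Jump targets are absolute, hence the parameter \<open>a\<close> for the address of the
  first instruction. An unconditional jump is a \<open>Branch\<close> with two equal
  targets.\<close>

fun compile :: "nat \<Rightarrow> com \<Rightarrow> instr list" where
  "compile a (Basic p) = [Op p]"
| "compile a (Seq c d) = compile a c @ compile (a + com_size c) d"
| "compile a (If b c d) =
     Branch b (a + 1) (a + com_size c + 2) # compile (a + 1) c @
     Branch b (a + com_size c + com_size d + 2) (a + com_size c + com_size d + 2) #
     compile (a + com_size c + 2) d"
| "compile a (While b c) =
     Branch b (a + 1) (a + com_size c + 2) # compile (a + 1) c @ [Branch b a a]"

lemma length_compile [simp]: "length (compile a c) = com_size c"
  by (induction c arbitrary: a) auto

fun instr_step :: "bool list \<Rightarrow> instr \<Rightarrow> nat \<times> mstate \<Rightarrow> nat \<times> mstate" where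
  "instr_step x (Op p) (pc, s) = (Suc pc, apply_op p s)"
| "instr_step x (Branch b m n) (pc, s) = (if holds x b s then m else n, s)"

definition code_step :: "bool list \<Rightarrow> instr list \<Rightarrow> nat \<times> mstate \<Rightarrow> nat \<times> mstate" where
  "code_step x P c = (if fst c < length P then instr_step x (P ! fst c) c else c)"

definition code_at :: "instr list \<Rightarrow> nat \<Rightarrow> instr list \<Rightarrow> bool" where
  "code_at P a Q \<longleftrightarrow> a + length Q \<le> length P \<and> (\<forall>i<length Q. P ! (a + i) = Q ! i)"

lemma code_at_append:
  "code_at P a (Q @ Q') \<longleftrightarrow> code_at P a Q \<and> code_at P (a + length Q) Q'"
proof
  assume *: "code_at P a (Q @ Q')"
  have "P ! (a + i) = Q ! i" if "i < length Q" for i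
    using * that unfolding code_at_def by (auto simp: nth_append dest: spec[of _ i])
  moreover have "P ! (a + length Q + i) = Q' ! i" if "i < length Q'" for i
    using * that unfolding code_at_def
    by (auto simp: nth_append add.assoc dest: spec[of _ "length Q + i"])
  ultimately show "code_at P a Q \<and> code_at P (a + length Q) Q'"
    using * unfolding code_at_def by auto
next
  assume *: "code_at P a Q \<and> code_at P (a + length Q) Q'"
  have "P ! (a + i) = (Q @ Q') ! i" if "i < length (Q @ Q')" for i
  proof (cases "i < length Q")
    case True
    then show ?thesis using * by (auto simp: code_at_def nth_append)
  next
    case False
    moreover have "P ! (a + length Q + (i - length Q)) = Q' ! (i - length Q)"
    proof -
      have "i - length Q < length Q'" using that False by simp
      then show ?thesis using * unfolding code_at_def by blast
    qed
    ultimately show ?thesis by (simp add: nth_append)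
  qed
  then show "code_at P a (Q @ Q')" using * unfolding code_at_def by auto
qed

lemma code_at_Cons:
  "code_at P a (i # Q) \<longleftrightarrow> a < length P \<and> P ! a = i \<and> code_at P (Suc a) Q"
  using code_at_append[of P a "[i]" Q] by (auto simp: code_at_def)

lemma funpow_trans: "(f ^^ m) a = b \<Longrightarrow> (f ^^ n) b = c \<Longrightarrow> (f ^^ (m + n)) a = c"
  by (simp only: add.commute[of m n] funpow_add o_apply)

lemma code_step_at: "a < length P \<Longrightarrow> P ! a = i \<Longrightarrow> code_step x P (a, s) = instr_step x i (a, s)"
  by (simp add: code_step_def)

text \<open>Rule induction with the address left general: subcommands are compiled at later
  addresses, while the remaining rounds of a loop start again at the address of the loop
  itself.\<close>

lemma exec_code_step:
  "exec x c s t s' \<Longrightarrow> code_at P a (compile a c) \<Longrightarrow>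
   (code_step x P ^^ t) (a, s) = (a + com_size c, s')"
proof (induction arbitrary: a rule: exec.induct)
  case (Basic p s)
  then show ?case by (simp add: code_at_Cons code_step_at)
next
  case (Seq c s t s' d u s'')
  have "(code_step x P ^^ t) (a, s) = (a + com_size c, s')"
    "(code_step x P ^^ u) (a + com_size c, s') = (a + com_size c + com_size d, s'')"
    using Seq by (auto simp: code_at_append)
  from funpow_trans[OF this] show ?case by (simp add: add.assoc)
next
  case (IfTrue b s c t s' d)
  have 1: "(code_step x P ^^ 1) (a, s) = (a + 1, s)"
    using IfTrue by (auto simp: code_at_Cons code_at_append code_step_at)
  have 2: "(code_step x P ^^ t) (a + 1, s) = (a + 1 + com_size c, s')"
    using IfTrue by (auto simp: code_at_Cons code_at_append)
  have 3: "(code_step x P ^^ 1) (a + 1 + com_size c, s') = (a + com_size (If b c d), s')"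
    using IfTrue by (auto simp: code_at_Cons code_at_append code_step_at)
  show ?case using funpow_trans[OF funpow_trans[OF 1 2] 3] by (simp add: add.commute)
next
  case (IfFalse b s d t s' c)
  have 1: "(code_step x P ^^ 1) (a, s) = (a + com_size c + 2, s)"
    using IfFalse by (auto simp: code_at_Cons code_at_append code_step_at)
  have 2: "(code_step x P ^^ t) (a + com_size c + 2, s) = (a + com_size c + 2 + com_size d, s')"
    using IfFalse by (auto simp: code_at_Cons code_at_append)
  show ?case using funpow_trans[OF 1 2] by (simp add: ac_simps)
next
  case (WhileFalse b s c)
  then show ?case by (simp add: code_at_Cons code_step_at)
next
  case (WhileTrue b s c t s' u s'')
  have 1: "(code_step x P ^^ 1) (a, s) = (a + 1, s)"
    using WhileTrue by (auto simp: code_at_Cons code_at_append code_step_at)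
  have 2: "(code_step x P ^^ t) (a + 1, s) = (a + 1 + com_size c, s')"
    using WhileTrue by (auto simp: code_at_Cons code_at_append)
  have 3: "(code_step x P ^^ 1) (a + 1 + com_size c, s') = (a, s')"
    using WhileTrue by (auto simp: code_at_Cons code_at_append code_step_at)
  have 4: "(code_step x P ^^ u) (a, s') = (a + com_size (While b c), s'')"
    using WhileTrue by auto
  show ?case using funpow_trans[OF funpow_trans[OF funpow_trans[OF 1 2] 3] 4]
    by (simp add: ac_simps)
qed

section \<open>Simulating jump code by a multi-tape machine\<close>

text \<open>
  Counter \<open>v\<close> is the head position on tape \<open>v + 1\<close>, whose cell 0 carries the mark 1.
\<close>

definition mark_tape :: "int \<Rightarrow> nat" where
  "mark_tape i = (if i = 0 then 1 else 0)"

text \<open>States 0, 1 and 2 have fixed meanings, so addresses are raised by 3. Every address past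
  the end of the code becomes the accepting state.\<close>

definition pc_state :: "nat \<Rightarrow> nat \<Rightarrow> nat" where
  "pc_state len pc = (if pc < len then pc + 3 else 1)"

text \<open>The tapes are the input, then the counters, then the output. Scanning the mark means
  that the counter is zero; \<open>Dec\<close> then keeps the head in place, in agreement with
  truncated subtraction.\<close>

fun actions :: "nat \<Rightarrow> nat list \<Rightarrow> op \<Rightarrow> (nat \<times> int) list" where
  "actions K ss p =
     (ss ! 0, case p of InL \<Rightarrow> -1 | InR \<Rightarrow> 1 | _ \<Rightarrow> 0) #
     map (\<lambda>v. (ss ! Suc v, if p = Inc v then 1 else if p = Dec v \<and> ss ! Suc v = 0 then -1 else 0))
       [0..<K] @
     [case p of Out b \<Rightarrow> (if b then 2 else 1, 1) | _ \<Rightarrow> (ss ! Suc K, 0)]"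

fun scan :: "cond \<Rightarrow> nat list \<Rightarrow> bool" where
  "scan (Nonzero v) ss \<longleftrightarrow> ss ! Suc v = 0"
| "scan NonBlank ss \<longleftrightarrow> ss ! 0 \<noteq> 0"
| "scan BitSet ss \<longleftrightarrow> ss ! 0 = 2"

text \<open>All counter tapes are blank at the start, so state 0 spends one step on writing the
  marks. Each later step executes one instruction.\<close>

definition code_delta :: "nat \<Rightarrow> instr list \<Rightarrow> nat \<Rightarrow> nat list \<Rightarrow> nat \<times> (nat \<times> int) list" where
  "code_delta K P q ss =
     (if q < 3 then
        (pc_state (length P) 0, (ss ! 0, 0) # replicate K (1, 0) @ [(ss ! Suc K, 0)])
      else case P ! (q - 3) of
        Op p \<Rightarrow> (pc_state (length P) (q - 2), actions K ss p)
      | Branch b m n \<Rightarrow> (pc_state (length P) (if scan b ss then m else n), actions K ss Nop))"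

definition code_tm :: "nat \<Rightarrow> instr list \<Rightarrow> tm" where
  "code_tm K P = \<lparr>num_tapes = K + 2, num_states = length P + 3, num_syms = 3,
     delta = code_delta K P\<rparr>"

lemma pc_state_less: "pc_state len pc < len + 3"
  by (simp add: pc_state_def)

lemma wf_code_tm: "wf_tm (code_tm K P)"
proof -
  have sym: "ss ! i < 3" if "\<forall>s\<in>set ss. s < 3" "length ss = K + 2" "i < K + 2" for ss i
    using that by (metis nth_mem)
  have act: "length (actions K ss p) = K + 2 \<and> (\<forall>(w, d)\<in>set (actions K ss p). w < 3 \<and> d \<in> {-1, 0, 1})"
    if "length ss = K + 2" "\<forall>s\<in>set ss. s < 3" for ss p
    using sym[OF that(2,1)] by (auto split: op.splits if_splits)
  show ?thesis
    unfolding wf_tm_def code_tm_def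
  proof (simp del: actions.simps, intro allI impI, elim conjE)
    fix q :: nat and ss :: "nat list"
    assume len: "length ss = Suc (Suc K)" and ss: "\<forall>s\<in>set ss. s < 3"
    note s = sym[OF ss, unfolded len, simplified]
    show "case code_delta K P q ss of (q', as) \<Rightarrow>
        q' < length P + 3 \<and> length as = Suc (Suc K) \<and>
        (\<forall>x\<in>set as. case x of (w, d) \<Rightarrow> w < 3 \<and> (d = - 1 \<or> d = 0 \<or> d = 1))"
      using act[of ss] len ss s[of 0] s[of "Suc K"]
      by (auto simp: code_delta_def pc_state_less simp del: actions.simps split: instr.splits)
  qed
qed

definition code_conf :: "nat \<Rightarrow> bool list \<Rightarrow> nat \<Rightarrow> nat \<times> mstate \<Rightarrow> tm_config" where
  "code_conf K x len = (\<lambda>(pc, h, c, os). (pc_state len pc,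
     (tape_of x, h) # map (\<lambda>v. (mark_tape, int (c v))) [0..<K] @ [(tape_of os, int (length os))]))"

fun op_bounded :: "nat \<Rightarrow> op \<Rightarrow> bool" where
  "op_bounded K (Inc v) \<longleftrightarrow> v < K"
| "op_bounded K (Dec v) \<longleftrightarrow> v < K"
| "op_bounded K _ \<longleftrightarrow> True"

fun cond_bounded :: "nat \<Rightarrow> cond \<Rightarrow> bool" where
  "cond_bounded K (Nonzero v) \<longleftrightarrow> v < K"
| "cond_bounded K _ \<longleftrightarrow> True"

fun instr_bounded :: "nat \<Rightarrow> instr \<Rightarrow> bool" where
  "instr_bounded K (Op p) \<longleftrightarrow> op_bounded K p"
| "instr_bounded K (Branch b m n) \<longleftrightarrow> cond_bounded K b"

fun com_bounded :: "nat \<Rightarrow> com \<Rightarrow> bool" where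
  "com_bounded K (Basic p) \<longleftrightarrow> op_bounded K p"
| "com_bounded K (Seq c d) \<longleftrightarrow> com_bounded K c \<and> com_bounded K d"
| "com_bounded K (If b c d) \<longleftrightarrow> cond_bounded K b \<and> com_bounded K c \<and> com_bounded K d"
| "com_bounded K (While b c) \<longleftrightarrow> cond_bounded K b \<and> com_bounded K c"

lemma com_bounded_compile: "com_bounded K c \<Longrightarrow> \<forall>i\<in>set (compile a c). instr_bounded K i"
  by (induction c arbitrary: a) auto

lemma tape_of_snoc: "tape_of (os @ [b]) = (tape_of os)(int (length os) := if b then 2 else 1)"
  by (auto simp: tape_of_def nth_append fun_eq_iff)

lemma map2_map_same: "map2 f (map g xs) (map h xs) = map (\<lambda>x. f (g x) (h x)) xs"
  by (induction xs) auto

lemma map2_append: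
  "length xs = length ys \<Longrightarrow> map2 f (xs @ xs') (ys @ ys') = map2 f xs ys @ map2 f xs' ys'"
  by (induction xs ys rule: list_induct2) auto

definition scanned :: "nat \<Rightarrow> bool list \<Rightarrow> mstate \<Rightarrow> nat list" where
  "scanned K x = (\<lambda>(h, c, os). tape_of x h # map (\<lambda>v. mark_tape (int (c v))) [0..<K] @ [0])"

lemma scanned_conf: "map (\<lambda>(t, h). t h) (snd (code_conf K x len (pc, s))) = scanned K x s"
  by (cases s) (simp add: code_conf_def scanned_def tape_of_def o_def)

lemma scanned_nth:
  "scanned K x (h, c, os) ! 0 = tape_of x h"
  "v < K \<Longrightarrow> scanned K x (h, c, os) ! Suc v = mark_tape (int (c v))"
  "scanned K x (h, c, os) ! Suc K = 0"
  by (simp_all add: scanned_def nth_append)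

lemma tape_of_end: "tape_of os (int (length os)) = 0"
  by (simp add: tape_of_def)

lemma actions_apply:
  assumes "op_bounded K p"
  shows "map2 (\<lambda>(w, d) (t, h). (t(h := w), h + d)) (actions K (scanned K x s) p)
           (snd (code_conf K x len (pc, s))) = snd (code_conf K x len (pc', apply_op p s))"
proof (cases s)
  case (fields h c os)
  show ?thesis
    using assms unfolding fields
    by (cases p) (auto simp: code_conf_def scanned_nth map2_append map2_map_same tape_of_end
        tape_of_snoc mark_tape_def fun_eq_iff of_nat_diff)
qed

lemma scan_scanned: "cond_bounded K b \<Longrightarrow> scan b (scanned K x s) = holds x b s"
  by (cases s; cases b) (auto simp: scanned_nth mark_tape_def)

lemma code_conf_step:
  assumes "\<forall>i\<in>set P. instr_bounded K i" "pc < length P"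
  shows "tm_step (code_tm K P) (code_conf K x (length P) (pc, s)) =
    code_conf K x (length P) (code_step x P (pc, s))"
proof -
  let ?C = "code_conf K x (length P) (pc, s)"
  have bnd: "instr_bounded K (P ! pc)" using assms by simp
  have q: "fst ?C = pc + 3" using assms(2) by (cases s) (simp add: code_conf_def pc_state_def)
  have nh: "\<not> halted ?C" by (simp add: halted_def q)
  have fst_conf: "fst (code_conf K x (length P) (pc', s')) = pc_state (length P) pc'" for pc' s'
    by (cases s') (simp add: code_conf_def)
  have step: "tm_step (code_tm K P) ?C =
    (case code_delta K P (pc + 3) (scanned K x s) of (q', as) \<Rightarrow>
       (q', map2 (\<lambda>(w, d) (t, h). (t(h := w), h + d)) as (snd ?C)))"
    unfolding tm_step_def using nh q scanned_conf[of K x "length P" pc s]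
    by (simp add: code_tm_def case_prod_unfold)
  show ?thesis
  proof (cases "P ! pc")
    case (Op p)
    then have "op_bounded K p" using bnd by simp
    note a = actions_apply[OF this, of x s "length P" pc "Suc pc"]
    show ?thesis
      unfolding step using Op assms(2) a
      by (intro prod_eqI) (simp_all add: code_delta_def code_step_def fst_conf del: actions.simps)
  next
    case (Branch b m n)
    then have b: "scan b (scanned K x s) = holds x b s" using bnd scan_scanned by simp
    note a = actions_apply[of K Nop x s "length P" pc "if holds x b s then m else n"]
    show ?thesis
      unfolding step using Branch assms(2) a b
      by (intro prod_eqI) (simp_all add: code_delta_def code_step_def fst_conf del: actions.simps)
  qed
qed

lemma code_conf_halted: "pc \<ge> length P \<Longrightarrow> halted (code_conf K x (length P) (pc, s))"
  by (cases s) (simp add: code_conf_def halted_def pc_state_def)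

lemma code_conf_steps:
  assumes "\<forall>i\<in>set P. instr_bounded K i"
  shows "(tm_step (code_tm K P) ^^ t) (code_conf K x (length P) c) =
    code_conf K x (length P) ((code_step x P ^^ t) c)"
proof (induction t)
  case (Suc t)
  obtain pc s where c: "(code_step x P ^^ t) c = (pc, s)" using prod.exhaust by blast
  show ?case
  proof (cases "pc < length P")
    case True
    then show ?thesis using Suc code_conf_step[OF assms True] c by simp
  next
    case False
    then have "tm_step (code_tm K P) (code_conf K x (length P) (pc, s)) = code_conf K x (length P) (pc, s)"
      using code_conf_halted[of P pc K x s] by (simp add: tm_step_def)
    moreover have "code_step x P (pc, s) = (pc, s)" using False by (simp add: code_step_def)
    ultimately show ?thesis using Suc c by simp
  qed
qed simp

lemma code_tm_first_step:
  "tm_step (code_tm K P) (tm_init (code_tm K P) x) = code_conf K x (length P) (0, 0, \<lambda>_. 0, [])"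
proof -
  have ini: "tm_init (code_tm K P) x =
      (0, (tape_of x, 0) # replicate K (tape_of [], 0) @ [(tape_of [], 0)])"
    by (simp add: tm_init_def code_tm_def replicate_append_same)
  have scan: "((tape_of x 0) # replicate K 0 @ [0]) ! Suc K = (0::nat)"
    by (simp add: nth_append)
  have mark: "(tape_of [])(0 := Suc 0) = mark_tape"
    by (auto simp: tape_of_def mark_tape_def)
  have blank: "tape_of [] i = 0" for i
    by (simp add: tape_of_def)
  have upd: "(tape_of [])(0 := 0) = tape_of []"
    by (auto simp: blank)
  show ?thesis
    unfolding tm_step_def ini
    by (simp add: halted_def code_tm_def code_delta_def code_conf_def map2_append upd blank
        nth_append mark zip_replicate map_replicate_const)
qed

lemma polytime_computable_exec:
  assumes bnd: "com_bounded K c"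
    and run: "\<And>x. \<exists>t\<le>poly p (length x). \<exists>h c'. exec x c (0, \<lambda>_. 0, []) t (h, c', f x)"
  shows "polytime_computable f"
proof -
  let ?P = "compile 0 c" and ?M = "code_tm K (compile 0 c)"
  \<comment> \<open>The additional unit pays for the step that writes the marks.\<close>
  have "\<exists>t\<le>poly (p + 1) (length x). halted (tm_run ?M x t) \<and>
      fst (last (snd (tm_run ?M x t))) = tape_of (f x)" for x
  proof -
    obtain t h c' where t: "t \<le> poly p (length x)" "exec x c (0, \<lambda>_. 0, []) t (h, c', f x)"
      using run by blast
    have "(code_step x ?P ^^ t) (0, 0, \<lambda>_. 0, []) = (length ?P, h, c', f x)"
      using exec_code_step[OF t(2), of ?P 0] by (simp add: code_at_def)
    then have "tm_run ?M x (Suc t) = code_conf K x (length ?P) (length ?P, h, c', f x)"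
      using code_conf_steps[OF com_bounded_compile[OF bnd]]
      by (simp only: tm_run_def funpow_Suc_right o_apply code_tm_first_step)
    then have "halted (tm_run ?M x (Suc t))" "fst (last (snd (tm_run ?M x (Suc t)))) = tape_of (f x)"
      using code_conf_halted[of ?P "length ?P" K x "(h, c', f x)"] by (simp_all add: code_conf_def)
    moreover have "Suc t \<le> poly (p + 1) (length x)" using t(1) by simp
    ultimately show ?thesis by blast
  qed
  then show ?thesis
    unfolding polytime_computable_def using wf_code_tm by blast
qed

section \<open>Generating lists of unary numbers\<close>

text \<open>An upper bound replaces the exact time, so that the two branches of a conditional, and
  all rounds of a loop, can share one bound.\<close>

definition runs :: "bool list \<Rightarrow> com \<Rightarrow> mstate \<Rightarrow> nat \<Rightarrow> mstate \<Rightarrow> bool" where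
  "runs x c s t s' \<longleftrightarrow> (\<exists>t'\<le>t. exec x c s t' s')"

lemma runs_mono: "runs x c s t s' \<Longrightarrow> t \<le> u \<Longrightarrow> runs x c s u s'"
  unfolding runs_def by (meson le_trans)

lemma runs_Basic: "apply_op p s = s' \<Longrightarrow> runs x (Basic p) s 1 s'"
  unfolding runs_def using exec.Basic by blast

lemma runs_Seq: "runs x c s t s' \<Longrightarrow> runs x d s' u s'' \<Longrightarrow> runs x (Seq c d) s (t + u) s''"
  unfolding runs_def by (meson add_mono exec.Seq)

lemma runs_If:
  assumes "holds x b s \<Longrightarrow> runs x c s t s'" "\<not> holds x b s \<Longrightarrow> runs x d s t s'"
  shows "runs x (If b c d) s (t + 2) s'"
proof (cases "holds x b s")
  case True
  then obtain t' where "t' \<le> t" "exec x c s t' s'" using assms(1) unfolding runs_def by blast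
  then show ?thesis using exec.IfTrue[OF True] unfolding runs_def by (metis add_le_mono1)
next
  case False
  then obtain t' where "t' \<le> t" "exec x d s t' s'" using assms(2) unfolding runs_def by blast
  then have "t' + 1 \<le> t + 2" "exec x (If b c d) s (t' + 1) s'"
    using exec.IfFalse[OF False] by auto
  then show ?thesis unfolding runs_def by blast
qed

text \<open>\<open>S j\<close> is the state after \<open>j\<close> rounds. The induction is on the
  number \<open>k\<close> of remaining rounds, because an execution of a loop is built up from its
  last test backwards.\<close>

lemma runs_While:
  assumes "\<And>j. j < N \<Longrightarrow> holds x b (S j) \<and> runs x c (S j) t (S (Suc j))" "\<not> holds x b (S N)"
  shows "runs x (While b c) (S 0) (N * (t + 2) + 1) (S N)"
proof -
  have "runs x (While b c) (S (N - k)) (k * (t + 2) + 1) (S N)" if "k \<le> N" for k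
    using that
  proof (induction k)
    case 0
    then show ?case using exec.WhileFalse[OF assms(2)] unfolding runs_def by auto
  next
    case (Suc k)
    let ?j = "N - Suc k"
    have j: "?j < N" "Suc ?j = N - k" using Suc.prems by auto
    obtain t1 where t1: "t1 \<le> t" "exec x c (S ?j) t1 (S (N - k))"
      using assms(1)[OF j(1)] j(2) unfolding runs_def by metis
    obtain t2 where t2: "t2 \<le> k * (t + 2) + 1" "exec x (While b c) (S (N - k)) t2 (S N)"
      using Suc unfolding runs_def by (meson Suc_leD)
    have "exec x (While b c) (S ?j) (t1 + t2 + 2) (S N)"
      using exec.WhileTrue[OF _ t1(2) t2(2)] assms(1)[OF j(1)] by blast
    moreover have "t1 + t2 + 2 \<le> Suc k * (t + 2) + 1" using t1(1) t2(1) by simp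
    ultimately show ?case unfolding runs_def by blast
  qed
  from this[of N] show ?thesis by simp
qed

text \<open>
  The loop moves the value of \<open>v\<close> to the auxiliary counter \<open>a\<close> and back, so that \<open>v\<close> survives.
\<close>

definition For :: "nat \<Rightarrow> nat \<Rightarrow> com \<Rightarrow> com" where
  "For v a c = Seq
     (While (Nonzero v) (Seq (Basic (Dec v)) (Seq (Basic (Inc a)) c)))
     (While (Nonzero a) (Seq (Basic (Dec a)) (Basic (Inc v))))"

text \<open>The body may change the head, the other counters and the output, as described by
  \<open>h\<close>, \<open>k\<close> and \<open>os\<close>, but has to preserve \<open>v\<close> and
  \<open>a\<close>. Per round the bound charges 4 on top of the body for counting and 4 for
  restoring \<open>v\<close>; the final 2 are the failing tests of the two loops.\<close>

lemma runs_For: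
  assumes "v \<noteq> a" and body: "\<And>j. j < N \<Longrightarrow>
    runs x c (h j, (k j)(v := N - Suc j, a := Suc j), os j) t
      (h (Suc j), (k (Suc j))(v := N - Suc j, a := Suc j), os (Suc j))"
  shows "runs x (For v a c) (h 0, (k 0)(v := N, a := 0), os 0) (N * (t + 8) + 2)
    (h N, (k N)(v := N, a := 0), os N)"
proof -
  let ?S = "\<lambda>j. (h j, (k j)(v := N - j, a := j), os j)"
  let ?R = "\<lambda>j. (h N, (k N)(v := j, a := N - j), os N)"
  have "runs x (While (Nonzero v) (Seq (Basic (Dec v)) (Seq (Basic (Inc a)) c))) (?S 0)
      (N * ((1 + (1 + t)) + 2) + 1) (?S N)"
  proof (rule runs_While)
    fix j assume j: "j < N"
    have "runs x (Basic (Dec v)) (?S j) 1 (h j, (k j)(v := N - Suc j, a := j), os j)"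
      using assms(1) by (intro runs_Basic) (auto simp: fun_eq_iff)
    moreover have "runs x (Basic (Inc a)) (h j, (k j)(v := N - Suc j, a := j), os j) 1
        (h j, (k j)(v := N - Suc j, a := Suc j), os j)"
      by (intro runs_Basic) auto
    moreover have "runs x c (h j, (k j)(v := N - Suc j, a := Suc j), os j) t (?S (Suc j))"
      using body[OF j] by simp
    ultimately show "holds x (Nonzero v) (?S j) \<and>
        runs x (Seq (Basic (Dec v)) (Seq (Basic (Inc a)) c)) (?S j) (1 + (1 + t)) (?S (Suc j))"
      using j assms(1) runs_Seq by (metis (no_types, lifting) fun_upd_other fun_upd_same holds.simps(1) zero_less_diff not_gr_zero)
  qed (use assms(1) in auto)
  moreover have "runs x (While (Nonzero a) (Seq (Basic (Dec a)) (Basic (Inc v)))) (?R 0)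
      (N * ((1 + 1) + 2) + 1) (?R N)"
  proof (rule runs_While)
    fix j assume j: "j < N"
    have "runs x (Basic (Dec a)) (?R j) 1 (h N, (k N)(v := j, a := N - Suc j), os N)"
      by (intro runs_Basic) (auto simp: fun_eq_iff)
    moreover have "runs x (Basic (Inc v)) (h N, (k N)(v := j, a := N - Suc j), os N) 1 (?R (Suc j))"
      using assms(1) by (intro runs_Basic) (auto simp: fun_eq_iff)
    ultimately show "holds x (Nonzero a) (?R j) \<and>
        runs x (Seq (Basic (Dec a)) (Basic (Inc v))) (?R j) (1 + 1) (?R (Suc j))"
      using j runs_Seq by (metis (no_types, lifting) fun_upd_same holds.simps(1) zero_less_diff not_gr_zero)
  qed auto
  ultimately have "runs x (For v a c) (?S 0)
      ((N * ((1 + (1 + t)) + 2) + 1) + (N * ((1 + 1) + 2) + 1)) (?R N)"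
    unfolding For_def by (intro runs_Seq[of _ _ _ _ "?S N"]) simp_all
  moreover have "(N * ((1 + (1 + t)) + 2) + 1) + (N * ((1 + 1) + 2) + 1) = N * (t + 8) + 2"
    by (simp add: algebra_simps)
  ultimately show ?thesis by (metis diff_zero diff_self_eq_0)
qed

definition seqs :: "com list \<Rightarrow> com" where
  "seqs cs = foldr Seq cs (Basic Nop)"

lemma com_bounded_seqs: "com_bounded K (seqs cs) \<longleftrightarrow> (\<forall>c\<in>set cs. com_bounded K c)"
  by (induction cs) (auto simp: seqs_def)

lemma com_bounded_For: "com_bounded K (For v a c) \<longleftrightarrow> v < K \<and> a < K \<and> com_bounded K c"
  by (auto simp: For_def)

lemma runs_Nop: "runs x (Basic Nop) s 1 s"
  by (rule runs_Basic) simp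

lemma runs_seqs_Cons:
  "runs x c s t s' \<Longrightarrow> runs x (seqs cs) s' u s'' \<Longrightarrow> runs x (seqs (c # cs)) s (t + u) s''"
  by (simp add: seqs_def runs_Seq)

definition out_bits :: "bool list \<Rightarrow> com" where
  "out_bits bs = seqs (map (\<lambda>b. Basic (Out b)) bs)"

lemma runs_out_bits: "runs x (out_bits bs) (h, k, os) (length bs + 1) (h, k, os @ bs)"
proof (induction bs arbitrary: os)
  case Nil
  then show ?case by (simp add: out_bits_def seqs_def runs_Nop[unfolded One_nat_def])
next
  case (Cons b bs)
  have "runs x (Basic (Out b)) (h, k, os) 1 (h, k, os @ [b])" by (rule runs_Basic) simp
  from runs_seqs_Cons[OF this Cons[of "os @ [b]", unfolded out_bits_def]] show ?case
    by (simp add: out_bits_def)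
qed

text \<open>
  \<open>Rep\<close> stands for \<open>m\<close> bits True for each unit of a counter, where \<open>m\<close> is a constant of the
  program. Thus a unary number that is affine in the counter is a list of tokens.
\<close>

datatype tok = Bit bool | Rep

definition expand :: "nat \<Rightarrow> nat \<Rightarrow> tok list \<Rightarrow> bool list" where
  "expand m i ts = concat (map (\<lambda>k. case k of Bit b \<Rightarrow> [b] | Rep \<Rightarrow> replicate (i * m) True) ts)"

definition emit :: "nat \<Rightarrow> nat \<Rightarrow> tok list \<Rightarrow> com" where
  "emit m v ts = seqs (map (\<lambda>k. case k of Bit b \<Rightarrow> Basic (Out b)
     | Rep \<Rightarrow> For v 6 (out_bits (replicate m True))) ts)"

lemma com_bounded_emit: "v < K \<Longrightarrow> 6 < K \<Longrightarrow> com_bounded K (emit m v ts)"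
  by (auto simp: emit_def com_bounded_seqs com_bounded_For out_bits_def split: tok.splits)

text \<open>A crude bound that charges every token as if it were a \<open>Rep\<close>.\<close>

definition emit_time :: "nat \<Rightarrow> tok list \<Rightarrow> nat \<Rightarrow> nat" where
  "emit_time m ts i = length ts * (i * (m + 9) + 3) + 1"

lemma runs_emit:
  assumes "v \<noteq> 6" "k 6 = 0" "k v = i"
  shows "runs x (emit m v ts) (h, k, os) (emit_time m ts i) (h, k, os @ expand m i ts)"
proof (induction ts arbitrary: os)
  case Nil
  then show ?case
    by (simp add: emit_def emit_time_def expand_def seqs_def runs_Nop[unfolded One_nat_def])
next
  case (Cons t ts)
  define c where "c = (case t of Bit b \<Rightarrow> Basic (Out b) | Rep \<Rightarrow> For v 6 (out_bits (replicate m True)))"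
  define e where "e = (case t of Bit b \<Rightarrow> [b] | Rep \<Rightarrow> replicate (i * m) True)"
  have "runs x c (h, k, os) (i * (m + 9) + 3) (h, k, os @ e)"
  proof (cases t)
    case (Bit b)
    have "runs x (Basic (Out b)) (h, k, os) 1 (h, k, os @ [b])" by (rule runs_Basic) simp
    then show ?thesis using Bit by (auto simp: c_def e_def elim: runs_mono)
  next
    case Rep
    have "runs x (out_bits (replicate m True)) (h, k', os @ replicate (j * m) True) (m + 1)
        (h, k', os @ replicate (Suc j * m) True)" for j k'
      using runs_out_bits[of x "replicate m True" h k' "os @ replicate (j * m) True"]
      by (simp add: replicate_add[symmetric] add.commute)
    from runs_For[OF assms(1), of i x _ "\<lambda>_. h" "\<lambda>_. k" "\<lambda>j. os @ replicate (j * m) True", OF this]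
    have "runs x (For v 6 (out_bits (replicate m True))) (h, k(v := i, 6 := 0), os) (i * (m + 1 + 8) + 2)
        (h, k(v := i, 6 := 0), os @ replicate (i * m) True)" by simp
    moreover have "k(v := i, 6 := 0) = k" using assms by auto
    moreover have "i * (m + 1 + 8) + 2 \<le> i * (m + 9) + 3" by (simp add: algebra_simps)
    ultimately show ?thesis using Rep runs_mono by (simp only: c_def e_def tok.case)
  qed
  from runs_seqs_Cons[OF this Cons[of "os @ e", unfolded emit_def]] show ?case
    by (simp add: emit_def emit_time_def expand_def c_def e_def algebra_simps)
qed

text \<open>Coefficients are natural numbers, so sums and products of bounds are again bounds, and
  the running time of the whole program can be estimated from its syntactic form.\<close>

definition poly_bounded :: "(nat \<Rightarrow> nat) \<Rightarrow> bool" where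
  "poly_bounded f \<longleftrightarrow> (\<exists>p :: nat poly. \<forall>n. f n \<le> poly p n)"

lemma poly_bounded_poly: "poly_bounded (poly p)"
  unfolding poly_bounded_def by auto

lemma poly_bounded_const: "poly_bounded (\<lambda>_. a)"
  unfolding poly_bounded_def by (intro exI[of _ "[:a:]"]) simp

lemma poly_bounded_id: "poly_bounded (\<lambda>n. n)"
  unfolding poly_bounded_def by (intro exI[of _ "[:0, 1:]"]) simp

lemma poly_bounded_add: "poly_bounded f \<Longrightarrow> poly_bounded g \<Longrightarrow> poly_bounded (\<lambda>n. f n + g n)"
  unfolding poly_bounded_def by (metis add_mono poly_add)

lemma poly_bounded_mult: "poly_bounded f \<Longrightarrow> poly_bounded g \<Longrightarrow> poly_bounded (\<lambda>n. f n * g n)"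
  unfolding poly_bounded_def by (metis mult_le_mono poly_mult)

lemmas poly_bounded_intros =
  poly_bounded_const poly_bounded_id poly_bounded_poly poly_bounded_add poly_bounded_mult

lemma poly_bounded_emit_time: "poly_bounded f \<Longrightarrow> poly_bounded (\<lambda>n. emit_time m ts (f n))"
  unfolding emit_time_def by (intro poly_bounded_intros)

text \<open>
  The counters of the generating program: input length, margin \<open>w\<close>, scratch, number \<open>t\<close> of inner
  cells, cell index, and two loop counters.
\<close>

definition counters :: "nat \<Rightarrow> nat \<Rightarrow> nat \<Rightarrow> nat \<Rightarrow> nat \<Rightarrow> nat \<Rightarrow> nat \<Rightarrow> nat \<Rightarrow> nat" where
  "counters n w v t i a b = (\<lambda>_. 0)(0 := n, 1 := w, 2 := v, 3 := t, 4 := i, 5 := a, 6 := b)"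

lemma counters_upd [simp]:
  "(counters n w v t i a b)(0 := y) = counters y w v t i a b"
  "(counters n w v t i a b)(Suc 0 := y) = counters n y v t i a b"
  "(counters n w v t i a b)(2 := y) = counters n w y t i a b"
  "(counters n w v t i a b)(3 := y) = counters n w v y i a b"
  "(counters n w v t i a b)(4 := y) = counters n w v t y a b"
  "(counters n w v t i a b)(5 := y) = counters n w v t i y b"
  "(counters n w v t i a b)(6 := y) = counters n w v t i a y"
  by (auto simp: counters_def)

lemma counters_sel [simp]:
  "counters n w v t i a b 0 = n" "counters n w v t i a b (Suc 0) = w" "counters n w v t i a b 2 = v"
  "counters n w v t i a b 3 = t" "counters n w v t i a b 4 = i" "counters n w v t i a b 5 = a"
  "counters n w v t i a b 6 = b"
  by (auto simp: counters_def)

lemma runs_Inc_times: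
  "runs x (seqs (replicate j (Basic (Inc 1)))) (h, counters n w v t i a b, os) (j + 1)
     (h, counters n (w + j) v t i a b, os)"
proof (induction j arbitrary: w)
  case 0
  then show ?case by (simp add: seqs_def runs_Nop[unfolded One_nat_def])
next
  case (Suc j)
  have "runs x (Basic (Inc 1)) (h, counters n w v t i a b, os) 1 (h, counters n (Suc w) v t i a b, os)"
    by (rule runs_Basic) simp
  from runs_seqs_Cons[OF this Suc[of "Suc w"]] show ?case by simp
qed

text \<open>Horner's rule.\<close>

lemma polynomial_program:
  "\<exists>c f. com_bounded 7 c \<and> poly_bounded f \<and>
     (\<forall>x h n os. runs x c (h, counters n 0 0 0 0 0 0, os) (f n) (h, counters n (poly p n) 0 0 0 0 0, os))"
proof (induction p)
  case 0
  have "runs x (Basic Nop) (h, counters n 0 0 0 0 0 0, os) 1 (h, counters n (poly 0 n) 0 0 0 0 0, os)" for x h n os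
    by (simp add: runs_Nop[unfolded One_nat_def])
  moreover have "poly_bounded (\<lambda>_. 1)" by (rule poly_bounded_const)
  moreover have "com_bounded 7 (Basic Nop)" by simp
  ultimately show ?case by (intro exI[of _ "Basic Nop"] exI[of _ "\<lambda>_. 1"] conjI allI)
next
  case (pCons j p)
  then obtain c f where c: "com_bounded 7 c" "poly_bounded f"
    "\<And>x h n os. runs x c (h, counters n 0 0 0 0 0 0, os) (f n) (h, counters n (poly p n) 0 0 0 0 0, os)"
    by blast
  \<comment> \<open>One Horner step from \<open>w\<close> to \<open>n * w + j\<close>:
    \<open>c1\<close> adds counter 1 to the scratch counter \<open>n\<close> times,
    \<open>c2\<close> clears counter 1, \<open>c3\<close> moves the product back into it, and
    \<open>c4\<close> adds the coefficient.\<close>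
  define c1 where "c1 = For 0 5 (For 1 6 (Basic (Inc 2)))"
  define c2 where "c2 = While (Nonzero 1) (Basic (Dec 1))"
  define c3 where "c3 = While (Nonzero 2) (Seq (Basic (Dec 2)) (Basic (Inc 1)))"
  define c4 where "c4 = seqs (replicate j (Basic (Inc 1)))"
  define g where "g n = f n + ((n * ((poly p n * (1 + 8) + 2) + 8) + 2) + ((poly p n * (1 + 2) + 1) +
    ((n * poly p n * ((1 + 1) + 2) + 1) + (j + 1))))" for n
  have "runs x (Seq c (Seq c1 (Seq c2 (Seq c3 c4)))) (h, counters n 0 0 0 0 0 0, os) (g n)
      (h, counters n (poly (pCons j p) n) 0 0 0 0 0, os)" for x h n os
  proof -
    let ?w = "poly p n"
    have inner: "runs x (For 1 6 (Basic (Inc 2))) (h, counters n' ?w v 0 0 a 0, os) (?w * (1 + 8) + 2)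
        (h, counters n' ?w (?w + v) 0 0 a 0, os)" for n' v a
      using runs_For[of 1 6 ?w x "Basic (Inc 2)" "\<lambda>_. h" "\<lambda>j. counters n' ?w (j + v) 0 0 a 0" "\<lambda>_. os" 1]
      by (simp add: runs_Basic[unfolded One_nat_def])
    have 1: "runs x c1 (h, counters n ?w 0 0 0 0 0, os) (n * ((?w * (1 + 8) + 2) + 8) + 2)
        (h, counters n ?w (n * ?w) 0 0 0 0, os)"
      using runs_For[of 0 5 n x "For 1 6 (Basic (Inc 2))" "\<lambda>_. h" "\<lambda>j. counters n ?w (j * ?w) 0 0 0 0" "\<lambda>_. os"
          "?w * (1 + 8) + 2"] inner
      by (simp add: c1_def)
    have 2: "runs x c2 (h, counters n ?w v 0 0 0 0, os) (?w * (1 + 2) + 1) (h, counters n 0 v 0 0 0 0, os)" for v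
      using runs_While[of ?w x "Nonzero 1" "\<lambda>j. (h, counters n (?w - j) v 0 0 0 0, os)" "Basic (Dec 1)" 1]
      by (simp add: c2_def runs_Basic[unfolded One_nat_def])
    have "runs x (Seq (Basic (Dec 2)) (Basic (Inc 1))) (h, counters n w (Suc v) 0 0 0 0, os) (1 + 1)
        (h, counters n (Suc w) v 0 0 0 0, os)" for w v
      by (intro runs_Seq[of _ _ _ _ "(h, counters n w v 0 0 0 0, os)"] runs_Basic) simp_all
    then have 3: "runs x c3 (h, counters n 0 v 0 0 0 0, os) (v * ((1 + 1) + 2) + 1) (h, counters n v 0 0 0 0 0, os)" for v
      using runs_While[of v x "Nonzero 2" "\<lambda>j. (h, counters n j (v - j) 0 0 0 0, os)"
          "Seq (Basic (Dec 2)) (Basic (Inc 1))" "1 + 1"]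
      by (simp add: c3_def Suc_diff_Suc[symmetric])
    have 4: "runs x c4 (h, counters n w 0 0 0 0 0, os) (j + 1) (h, counters n (w + j) 0 0 0 0 0, os)" for w
      unfolding c4_def by (rule runs_Inc_times)
    have "runs x (Seq c (Seq c1 (Seq c2 (Seq c3 c4)))) (h, counters n 0 0 0 0 0 0, os) (g n)
      (h, counters n (n * ?w + j) 0 0 0 0 0, os)"
      unfolding g_def by (intro runs_Seq[OF c(3)] runs_Seq[OF 1] runs_Seq[OF 2] runs_Seq[OF 3] 4)
    then show ?thesis by (simp add: add.commute)
  qed
  moreover have "poly_bounded g"
    unfolding g_def by (intro poly_bounded_intros c(2))
  moreover have "com_bounded 7 (Seq c (Seq c1 (Seq c2 (Seq c3 c4))))"
    using c(1) by (simp add: c1_def c2_def c3_def c4_def com_bounded_For com_bounded_seqs)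
  ultimately show ?case by blast
qed

section \<open>Describing the cells of the row one after another\<close>

definition cell_com :: "nat \<Rightarrow> tok list \<Rightarrow> com" where
  "cell_com m ts = Seq (emit m 4 ts) (Basic (Inc 4))"

lemma emit_time_mono: "i \<le> j \<Longrightarrow> emit_time m ts i \<le> emit_time m ts j"
  by (simp add: emit_time_def)

text \<open>The cell index grows while a loop runs. Since \<open>emit_time\<close> is monotone in
  it, the time is stated for an upper bound \<open>u\<close>, which gives all rounds the same
  bound.\<close>

lemma runs_cell_com:
  assumes "k 6 = 0" "k 4 \<le> u"
  shows "runs x (cell_com m ts) (h, k, os) (emit_time m ts u + 1)
    (h, k(4 := Suc (k 4)), os @ expand m (k 4) ts)"
proof -
  have "runs x (emit m 4 ts) (h, k, os) (emit_time m ts (k 4)) (h, k, os @ expand m (k 4) ts)"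
    by (rule runs_emit) (use assms in auto)
  then have "runs x (emit m 4 ts) (h, k, os) (emit_time m ts u) (h, k, os @ expand m (k 4) ts)"
    using emit_time_mono[OF assms(2)] by (rule runs_mono)
  moreover have "runs x (Basic (Inc 4)) (h, k, os') 1 (h, k(4 := Suc (k 4)), os')" for os'
    by (rule runs_Basic) simp
  ultimately show ?thesis unfolding cell_com_def by (rule runs_Seq)
qed

lemma runs_cells:
  assumes v: "v \<notin> {4, 5, 6}" and k: "k 5 = 0" "k 6 = 0" "k 4 + k v \<le> u"
  shows "runs x (For v 5 (cell_com m ts)) (h, k, os) (k v * (emit_time m ts u + 1 + 8) + 2)
    (h, k(4 := k 4 + k v), os @ concat (map (\<lambda>i. expand m i ts) [k 4..<k 4 + k v]))"
proof -
  let ?k = "\<lambda>j. k(4 := k 4 + j)"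
  let ?os = "\<lambda>j. os @ concat (map (\<lambda>i. expand m i ts) [k 4..<k 4 + j])"
  have "runs x (For v 5 (cell_com m ts)) (h, (?k 0)(v := k v, 5 := 0), ?os 0)
      (k v * (emit_time m ts u + 1 + 8) + 2) (h, (?k (k v))(v := k v, 5 := 0), ?os (k v))"
  proof (rule runs_For)
    fix j assume j: "j < k v"
    let ?k' = "(?k j)(v := k v - Suc j, 5 := Suc j)"
    have 1: "?k' 6 = 0" "?k' 4 = k 4 + j" using v k by auto
    then have "runs x (cell_com m ts) (h, ?k', ?os j) (emit_time m ts u + 1)
        (h, ?k'(4 := Suc (k 4 + j)), ?os j @ expand m (k 4 + j) ts)"
      using runs_cell_com[of ?k' u x m ts h "?os j"] j k(3) by simp
    moreover have "?k'(4 := Suc (k 4 + j)) = (?k (Suc j))(v := k v - Suc j, 5 := Suc j)"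
      using v by (auto simp: fun_eq_iff)
    ultimately show "runs x (cell_com m ts) (h, ?k', ?os j) (emit_time m ts u + 1)
        (h, (?k (Suc j))(v := k v - Suc j, 5 := Suc j), ?os (Suc j))"
      by simp
  qed (use v in auto)
  moreover have "(?k 0)(v := k v, 5 := 0) = k" using k by auto
  moreover have "(?k (k v))(v := k v, 5 := 0) = ?k (k v)" using k v by auto
  ultimately show ?thesis by simp
qed

text \<open>The input head starts at position 0 and moves right once per round, so that round
  \<open>j\<close> tests bit \<open>j\<close>. Adding the times of the two branches gives a bound
  for either.\<close>

lemma runs_input_cells:
  assumes k: "k 5 = 0" "k 6 = 0" "k 0 = length x" "k 4 + length x \<le> u"
  shows "runs x (For 0 5 (Seq (If BitSet (cell_com m tt) (cell_com m tf)) (Basic InR))) (0, k, os)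
    (length x * (emit_time m tt u + emit_time m tf u + 1 + 2 + 1 + 8) + 2)
    (int (length x), k(4 := k 4 + length x),
     os @ concat (map (\<lambda>j. expand m (k 4 + j) (if x ! j then tt else tf)) [0..<length x]))"
proof -
  let ?k = "\<lambda>j. k(4 := k 4 + j)"
  let ?os = "\<lambda>j. os @ concat (map (\<lambda>j. expand m (k 4 + j) (if x ! j then tt else tf)) [0..<j])"
  let ?t = "emit_time m tt u + emit_time m tf u + 1"
  have "runs x (For 0 5 (Seq (If BitSet (cell_com m tt) (cell_com m tf)) (Basic InR)))
      (int 0, (?k 0)(0 := length x, 5 := 0), ?os 0)
      (length x * (?t + 2 + 1 + 8) + 2) (int (length x), (?k (length x))(0 := length x, 5 := 0), ?os (length x))"
  proof (rule runs_For)
    fix j assume j: "j < length x"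
    let ?k' = "(?k j)(0 := length x - Suc j, 5 := Suc j)"
    let ?k'' = "(?k (Suc j))(0 := length x - Suc j, 5 := Suc j)"
    have 1: "?k' 6 = 0" "?k' 4 = k 4 + j" using k by auto
    have "?k'(4 := Suc (k 4 + j)) = ?k''"
      by (auto simp: fun_eq_iff)
    then have cell: "runs x (cell_com m ts) (int j, ?k', ?os j) (emit_time m ts u + 1)
        (int j, ?k'', ?os j @ expand m (k 4 + j) ts)" for ts
      using runs_cell_com[of ?k' u x m ts "int j" "?os j"] j k 1 by simp
    have bit: "holds x BitSet (int j, ?k', ?os j) \<longleftrightarrow> x ! j"
      using j by (simp add: tape_of_def)
    have "runs x (If BitSet (cell_com m tt) (cell_com m tf)) (int j, ?k', ?os j) (?t + 2)
        (int j, ?k'', ?os (Suc j))"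
    proof (rule runs_If)
      show "runs x (cell_com m tt) (int j, ?k', ?os j) ?t (int j, ?k'', ?os (Suc j))"
        if "holds x BitSet (int j, ?k', ?os j)"
        using runs_mono[OF cell[of tt], of ?t] that unfolding bit by simp
      show "runs x (cell_com m tf) (int j, ?k', ?os j) ?t (int j, ?k'', ?os (Suc j))"
        if "\<not> holds x BitSet (int j, ?k', ?os j)"
        using runs_mono[OF cell[of tf], of ?t] that unfolding bit by simp
    qed
    moreover have "runs x (Basic InR) (int j, ?k'', ?os (Suc j)) 1 (int (Suc j), ?k'', ?os (Suc j))"
      by (rule runs_Basic) simp
    ultimately show "runs x (Seq (If BitSet (cell_com m tt) (cell_com m tf)) (Basic InR))
        (int j, ?k', ?os j) (?t + 2 + 1) (int (Suc j), ?k'', ?os (Suc j))"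
      by (rule runs_Seq)
  qed simp
  moreover have "(?k 0)(0 := length x, 5 := 0) = k" using k by auto
  moreover have "(?k (length x))(0 := length x, 5 := 0) = ?k (length x)" using k by auto
  ultimately show ?thesis by simp
qed

text \<open>Input bits are written as the symbols 1 and 2, so the first blank marks the end of the
  input and lets the program find its length.\<close>

lemma runs_count_input:
  "runs x (While NonBlank (Seq (Basic (Inc 0)) (Basic InR))) (0, \<lambda>_. 0, [])
     (length x * (1 + 1 + 2) + 1) (int (length x), counters (length x) 0 0 0 0 0 0, [])"
proof -
  have zero: "(\<lambda>_. 0) = counters 0 0 0 0 0 0 0" by (auto simp: counters_def)
  let ?S = "\<lambda>j. (int j, counters j 0 0 0 0 0 0, [])"
  have "runs x (While NonBlank (Seq (Basic (Inc 0)) (Basic InR))) (?S 0) (length x * (1 + 1 + 2) + 1)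
      (?S (length x))"
  proof (rule runs_While)
    fix j assume j: "j < length x"
    have "runs x (Seq (Basic (Inc 0)) (Basic InR)) (?S j) (1 + 1) (?S (Suc j))"
      by (intro runs_Seq[of _ _ _ _ "(int j, counters (Suc j) 0 0 0 0 0 0, [])"] runs_Basic) simp_all
    then show "holds x NonBlank (?S j) \<and> runs x (Seq (Basic (Inc 0)) (Basic InR)) (?S j) (1 + 1) (?S (Suc j))"
      using j by (simp add: tape_of_def)
  qed (simp add: tape_of_def)
  then show ?thesis by (simp add: zero)
qed

lemma runs_rewind:
  "runs x (For 0 5 (Basic InL)) (int n, counters n w v t i 0 b, os) (n * (1 + 8) + 2) (0, counters n w v t i 0 b, os)"
  using runs_For[of 0 5 n x "Basic InL" "\<lambda>j. int n - int j" "\<lambda>_. counters n w v t i 0 b" "\<lambda>_. os" 1]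
  by (simp add: runs_Basic[unfolded One_nat_def])

lemma runs_reset:
  "runs x (While (Nonzero 4) (Basic (Dec 4))) (h, counters n w v t i a b, os) (i * (1 + 2) + 1) (h, counters n w v t 0 a b, os)"
  using runs_While[of i x "Nonzero 4" "\<lambda>j. (h, counters n w v t (i - j) a b, os)" "Basic (Dec 4)" 1]
  by (simp add: runs_Basic[unfolded One_nat_def])

lemma runs_total:
  "runs x (Seq (Basic (Inc 3)) (Seq (For 1 5 (Seq (Basic (Inc 3)) (Basic (Inc 3)))) (For 0 5 (Basic (Inc 3)))))
     (h, counters n w 0 0 0 0 0, os) (1 + ((w * (1 + 1 + 8) + 2) + (n * (1 + 8) + 2)))
     (h, counters n w 0 (2 * w + n + 1) 0 0 0, os)"
proof -
  have 1: "runs x (Basic (Inc 3)) (h, counters n w 0 0 0 0 0, os) 1 (h, counters n w 0 1 0 0 0, os)"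
    by (rule runs_Basic) simp
  have "runs x (Seq (Basic (Inc 3)) (Basic (Inc 3))) (h, counters n w' 0 t 0 a 0, os) (1 + 1)
      (h, counters n w' 0 (Suc (Suc t)) 0 a 0, os)" for w' t a
    by (intro runs_Seq[of _ _ _ _ "(h, counters n w' 0 (Suc t) 0 a 0, os)"] runs_Basic) simp_all
  then have 2: "runs x (For 1 5 (Seq (Basic (Inc 3)) (Basic (Inc 3)))) (h, counters n w 0 1 0 0 0, os)
      (w * (1 + 1 + 8) + 2) (h, counters n w 0 (2 * w + 1) 0 0 0, os)"
    using runs_For[of 1 5 w x "Seq (Basic (Inc 3)) (Basic (Inc 3))" "\<lambda>_. h" "\<lambda>j. counters n w 0 (2 * j + 1) 0 0 0"
        "\<lambda>_. os" "1 + 1"]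
    by simp
  have 3: "runs x (For 0 5 (Basic (Inc 3))) (h, counters n w 0 (2 * w + 1) 0 0 0, os) (n * (1 + 8) + 2)
      (h, counters n w 0 (2 * w + n + 1) 0 0 0, os)"
    using runs_For[of 0 5 n x "Basic (Inc 3)" "\<lambda>_. h" "\<lambda>j. counters n w 0 (2 * w + j + 1) 0 0 0" "\<lambda>_. os" 1]
    by (simp add: runs_Basic[unfolded One_nat_def])
  show ?thesis by (rule runs_Seq[OF 1 runs_Seq[OF 2 3]])
qed

text \<open>The tape origin lies at cell \<open>w + 2\<close>. The cell to its left gets the tokens
  \<open>D'\<close>, because it will hold the sender that delivers the head to the origin.\<close>

definition cell_toks :: "(nat \<Rightarrow> tok list) \<Rightarrow> tok list \<Rightarrow> bool list \<Rightarrow> nat \<Rightarrow> nat \<Rightarrow> tok list" where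
  "cell_toks D D' x w i = (if i = w + 1 then D' else D (tape_of x (int i - int (w + 2))))"

text \<open>The row is cut where the program passes from one loop to the next. Only loops of
  \<open>w\<close> or \<open>n\<close> rounds are at hand, so each blank margin of
  \<open>w + 1\<close> cells is a loop of \<open>w\<close> rounds and a single cell; with the sender
  and the input this makes \<open>2 * w + n + 3\<close> cells.\<close>

lemma cell_toks_segments:
  fixes w :: nat and x :: "bool list"
  defines "n \<equiv> length x"
  shows "concat (map (\<lambda>i. expand m i (cell_toks D D' x w i)) [0..<2 * w + n + 1 + 2]) =
    concat (map (\<lambda>i. expand m i (D 0)) [0..<w]) @ expand m w (D 0) @ expand m (w + 1) D' @
    concat (map (\<lambda>j. expand m (w + 2 + j) (if x ! j then D 2 else D 1)) [0..<n]) @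
    concat (map (\<lambda>i. expand m i (D 0)) [w + 2 + n..<w + 2 + n + w]) @ expand m (w + 2 + n + w) (D 0)"
proof -
  let ?F = "\<lambda>i. expand m i (cell_toks D D' x w i)"
  have split: "[a..<c] = [a..<b] @ [b..<c]" if "a \<le> b" "b \<le> c" for a b c
    using upt_add_eq_append[OF that(1), of "c - b"] that(2) by simp
  have "[0..<2 * w + n + 1 + 2] = [0..<w] @ [w..<w + 1] @ [w + 1..<w + 2] @ [w + 2..<w + 2 + n] @
      [w + 2 + n..<w + 2 + n + w] @ [w + 2 + n + w..<2 * w + n + 1 + 2]"
    using split[of 0 w "2 * w + n + 1 + 2"] split[of w "w + 1" "2 * w + n + 1 + 2"]
      split[of "w + 1" "w + 2" "2 * w + n + 1 + 2"] split[of "w + 2" "w + 2 + n" "2 * w + n + 1 + 2"]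
      split[of "w + 2 + n" "w + 2 + n + w" "2 * w + n + 1 + 2"] by (simp del: upt_Suc)
  moreover have "[w..<w + 1] = [w]" "[w + 1..<w + 2] = [w + 1]"
    "[w + 2 + n + w..<2 * w + n + 1 + 2] = [w + 2 + n + w]"
    by (simp_all add: upt_rec[of "Suc (Suc (w + n + w))"] upt_rec[of "Suc w"])
  ultimately have "[0..<2 * w + n + 1 + 2] = [0..<w] @ [w] @ [w + 1] @ [w + 2..<w + 2 + n] @
      [w + 2 + n..<w + 2 + n + w] @ [w + 2 + n + w]" by simp
  then have "concat (map ?F [0..<2 * w + n + 1 + 2]) =
      concat (map ?F [0..<w]) @ ?F w @ ?F (w + 1) @ concat (map ?F [w + 2..<w + 2 + n]) @
      concat (map ?F [w + 2 + n..<w + 2 + n + w]) @ ?F (w + 2 + n + w)"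
    by (simp only: map_append concat_append list.map concat.simps append_Nil2 append_assoc)
  moreover have blank: "?F i = expand m i (D 0)" if "i \<le> w \<or> w + 2 + n \<le> i" for i
    using that by (auto simp: cell_toks_def tape_of_def n_def)
  moreover have "?F (w + 1) = expand m (w + 1) D'" by (simp add: cell_toks_def)
  moreover have "map ?F [0..<w] = map (\<lambda>i. expand m i (D 0)) [0..<w]"
    by (rule map_cong[OF refl], rule blank, unfold set_upt) auto
  moreover have "map ?F [w + 2 + n..<w + 2 + n + w] = map (\<lambda>i. expand m i (D 0)) [w + 2 + n..<w + 2 + n + w]"
    by (rule map_cong[OF refl], rule blank, unfold set_upt) auto
  moreover have "map ?F [w + 2..<w + 2 + n] =
      map (\<lambda>j. expand m (w + 2 + j) (if x ! j then D 2 else D 1)) [0..<n]"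
  proof -
    have "[w + 2..<w + 2 + n] = map (\<lambda>j. j + (w + 2)) [0..<n]"
      using map_add_upt[of "w + 2" n] by (simp only: add.commute)
    then have "map ?F [w + 2..<w + 2 + n] = map (\<lambda>j. ?F (j + (w + 2))) [0..<n]"
      by (simp only: map_map o_def)
    also have "\<dots> = map (\<lambda>j. expand m (w + 2 + j) (if x ! j then D 2 else D 1)) [0..<n]"
      by (rule map_cong[OF refl], unfold set_upt) (simp add: cell_toks_def tape_of_def n_def add.commute)
    finally show ?thesis .
  qed
  ultimately show ?thesis by (simp only: le_refl le_add1 simp_thms)
qed

text \<open>The four constant bits end the list of edges and encode the start location 0 and the
  exit location 1. Edges and buttons belong to \<open>t\<close> inner cells, doors also to the two
  border cells, hence \<open>t + 2\<close>.\<close>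

definition generated :: "nat \<Rightarrow> nat poly \<Rightarrow> tok list \<Rightarrow> tok list \<Rightarrow> (nat \<Rightarrow> tok list) \<Rightarrow> tok list \<Rightarrow>
    tok list \<Rightarrow> bool list \<Rightarrow> bool list" where
  "generated m p L E D D' B x = (let w = poly p (length x); t = 2 * w + length x + 1 in
     expand m t L @ concat (map (\<lambda>i. expand m i E) [0..<t]) @ [False, False, True, False] @
     concat (map (\<lambda>i. expand m i (cell_toks D D' x w i)) [0..<t + 2]) @ [False] @
     concat (map (\<lambda>i. expand m i B) [0..<t]) @ [False])"

theorem polytime_computable_generated: "polytime_computable (generated m p L E D D' B)"
proof -
  obtain cw f where cw: "com_bounded 7 cw" "poly_bounded f"
    "\<And>x h n os. runs x cw (h, counters n 0 0 0 0 0 0, os) (f n) (h, counters n (poly p n) 0 0 0 0 0, os)"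
    using polynomial_program by blast
  \<comment> \<open>The largest value of the cell counter, attained after the doors have been
    written.\<close>
  define u where "u n = 2 * poly p n + n + 1 + 2" for n
  define ct where "ct n ts = emit_time m ts (u n) + 1" for n ts
  define reset where "reset = While (Nonzero 4) (Basic (Dec 4))"
  define total where "total = Seq (Basic (Inc 3))
    (Seq (For 1 5 (Seq (Basic (Inc 3)) (Basic (Inc 3)))) (For 0 5 (Basic (Inc 3))))"
  define prog where "prog =
    Seq (While NonBlank (Seq (Basic (Inc 0)) (Basic InR)))
    (Seq (For 0 5 (Basic InL))
    (Seq cw
    (Seq total
    (Seq (emit m 3 L)
    (Seq (For 3 5 (cell_com m E))
    (Seq (out_bits [False, False, True, False])
    (Seq reset
    (Seq (For 1 5 (cell_com m (D 0)))
    (Seq (cell_com m (D 0))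
    (Seq (cell_com m D')
    (Seq (For 0 5 (Seq (If BitSet (cell_com m (D 2)) (cell_com m (D 1))) (Basic InR)))
    (Seq (For 1 5 (cell_com m (D 0)))
    (Seq (cell_com m (D 0))
    (Seq (out_bits [False])
    (Seq reset
    (Seq (For 3 5 (cell_com m B))
    (out_bits [False])))))))))))))))))"
  define T where "T n =
    (n * (1 + 1 + 2) + 1) + (
    (n * (1 + 8) + 2) + (
    f n + (
    (1 + ((poly p n * (1 + 1 + 8) + 2) + (n * (1 + 8) + 2))) + (
    emit_time m L (2 * poly p n + n + 1) + (
    ((2 * poly p n + n + 1) * (ct n E + 8) + 2) + (
    (4 + 1) + (
    ((2 * poly p n + n + 1) * (1 + 2) + 1) + (
    (poly p n * (ct n (D 0) + 8) + 2) + (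
    ct n (D 0) + (
    ct n D' + (
    (n * (emit_time m (D 2) (u n) + emit_time m (D 1) (u n) + 1 + 2 + 1 + 8) + 2) + (
    (poly p n * (ct n (D 0) + 8) + 2) + (
    ct n (D 0) + (
    (1 + 1) + (
    (u n * (1 + 2) + 1) + (
    ((2 * poly p n + n + 1) * (ct n B + 8) + 2) + (
    (1 + 1))))))))))))))))))" for n
  have bounded: "com_bounded 7 prog"
    using cw(1) by (simp add: prog_def reset_def total_def com_bounded_For com_bounded_emit cell_com_def
        out_bits_def com_bounded_seqs)
  have u: "poly_bounded u"
    unfolding u_def by (intro poly_bounded_intros)
  have "poly_bounded T"
    unfolding T_def ct_def
    by (intro poly_bounded_intros poly_bounded_emit_time cw(2) u)
  then obtain q where q: "\<And>n. T n \<le> poly q n" unfolding poly_bounded_def by blast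
  have "runs x prog (0, \<lambda>_. 0, []) (T (length x))
      (int (length x), counters (length x) (poly p (length x)) 0 (2 * poly p (length x) + length x + 1)
         (2 * poly p (length x) + length x + 1) 0 0, generated m p L E D D' B x)" for x
  proof -
    define n where "n = length x"
    define w where "w = poly p n"
    define t where "t = 2 * w + n + 1"
    define N where "N = int n"
    define k where "k i = counters n w 0 t i 0 0" for i
    have sel: "k i 0 = n" "k i 1 = w" "k i 3 = t" "k i 4 = i" "k i 5 = 0" "k i 6 = 0" for i
      by (simp_all add: k_def)
    have upd: "(k i)(4 := j) = k j" for i j by (simp add: k_def)
    have un: "u n = t + 2" by (simp add: u_def t_def w_def)
    define o1 where "o1 = expand m t L"
    define o2 where "o2 = o1 @ concat (map (\<lambda>i. expand m i E) [0..<t])"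
    define o3 where "o3 = o2 @ [False, False, True, False]"
    define o4 where "o4 = o3 @ concat (map (\<lambda>i. expand m i (D 0)) [0..<w])"
    define o5 where "o5 = o4 @ expand m w (D 0)"
    define o6 where "o6 = o5 @ expand m (w + 1) D'"
    define o7 where "o7 = o6 @ concat (map (\<lambda>j. expand m (w + 2 + j) (if x ! j then D 2 else D 1)) [0..<n])"
    define o8 where "o8 = o7 @ concat (map (\<lambda>i. expand m i (D 0)) [w + 2 + n..<w + 2 + n + w])"
    define o9 where "o9 = o8 @ expand m (w + 2 + n + w) (D 0)"
    define o10 where "o10 = o9 @ [False]"
    define o11 where "o11 = o10 @ concat (map (\<lambda>i. expand m i B) [0..<t])"
    have 1: "runs x (While NonBlank (Seq (Basic (Inc 0)) (Basic InR))) (0, \<lambda>_. 0, [])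
       (n * (1 + 1 + 2) + 1) (N, counters n 0 0 0 0 0 0, [])"
      unfolding n_def N_def by (rule runs_count_input)
    have 2: "runs x (For 0 5 (Basic InL)) (N, counters n 0 0 0 0 0 0, []) (n * (1 + 8) + 2)
        (0, counters n 0 0 0 0 0 0, [])"
      unfolding N_def by (rule runs_rewind)
    have 3: "runs x cw (0, counters n 0 0 0 0 0 0, []) (f n) (0, counters n w 0 0 0 0 0, [])"
      unfolding w_def by (rule cw(3))
    have 4: "runs x total (0, counters n w 0 0 0 0 0, []) (1 + ((w * (1 + 1 + 8) + 2) + (n * (1 + 8) + 2)))
        (0, k 0, [])"
      unfolding total_def k_def t_def by (rule runs_total)
    have 5: "runs x (emit m 3 L) (0, k 0, []) (emit_time m L t) (0, k 0, o1)"
      using runs_emit[of 3 "k 0" t x m L 0 "[]"] sel by (simp add: o1_def)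
    have 6: "runs x (For 3 5 (cell_com m E)) (0, k 0, o1) (t * (ct n E + 8) + 2) (0, k t, o2)"
      using runs_cells[of 3 "k 0" "u n" x m E 0 o1] sel by (simp del: upt_Suc add: upd un ct_def o2_def)
    have 7: "runs x (out_bits [False, False, True, False]) (0, k t, o2) (4 + 1) (0, k t, o3)"
      unfolding o3_def by (rule runs_mono[OF runs_out_bits]) simp
    have 8: "runs x reset (h, k i, os) (i * (1 + 2) + 1) (h, k 0, os)" for h i os
      unfolding reset_def k_def by (rule runs_reset)
    have 9: "runs x (For 1 5 (cell_com m (D 0))) (0, k 0, o3) (w * (ct n (D 0) + 8) + 2) (0, k w, o4)"
      using runs_cells[of 1 "k 0" "u n" x m "D 0" 0 o3] sel by (simp del: upt_Suc add: upd un ct_def o4_def t_def)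
    have 10: "runs x (cell_com m (D 0)) (0, k w, o4) (ct n (D 0)) (0, k (w + 1), o5)"
      using runs_cell_com[of "k w" "u n" x m "D 0" 0 o4] sel by (simp del: upt_Suc add: upd un ct_def o5_def t_def)
    have 11: "runs x (cell_com m D') (0, k (w + 1), o5) (ct n D') (0, k (w + 2), o6)"
      using runs_cell_com[of "k (w + 1)" "u n" x m D' 0 o5] sel by (simp del: upt_Suc add: upd un ct_def o6_def t_def)
    have 12: "runs x (For 0 5 (Seq (If BitSet (cell_com m (D 2)) (cell_com m (D 1))) (Basic InR)))
        (0, k (w + 2), o6) (n * (emit_time m (D 2) (u n) + emit_time m (D 1) (u n) + 1 + 2 + 1 + 8) + 2)
        (N, k (w + 2 + n), o7)"
      using runs_input_cells[of "k (w + 2)" x "u n" m "D 2" "D 1" o6] sel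
      by (simp del: upt_Suc add: upd un o7_def t_def N_def flip: n_def)
    have 13: "runs x (For 1 5 (cell_com m (D 0))) (N, k (w + 2 + n), o7) (w * (ct n (D 0) + 8) + 2)
        (N, k (w + 2 + n + w), o8)"
      using runs_cells[of 1 "k (w + 2 + n)" "u n" x m "D 0" N o7] sel
      by (simp del: upt_Suc add: upd un ct_def o8_def t_def)
    have 14: "runs x (cell_com m (D 0)) (N, k (w + 2 + n + w), o8) (ct n (D 0)) (N, k (t + 2), o9)"
      using runs_cell_com[of "k (w + 2 + n + w)" "u n" x m "D 0" N o8] sel
      by (simp del: upt_Suc add: upd un ct_def o9_def t_def mult_2 add.commute add.left_commute)
    have 15: "runs x (out_bits [False]) (N, k (t + 2), o9) (1 + 1) (N, k (t + 2), o10)"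
      using runs_out_bits[of x "[False]" N "k (t + 2)" o9] by (simp add: o10_def)
    have 18: "runs x reset (N, k (t + 2), o10) (u n * (1 + 2) + 1) (N, k 0, o10)"
      using 8[of N "t + 2" o10] by (simp only: un)
    have 16: "runs x (For 3 5 (cell_com m B)) (N, k 0, o10) (t * (ct n B + 8) + 2) (N, k t, o11)"
      using runs_cells[of 3 "k 0" "u n" x m B N o10] sel by (simp del: upt_Suc add: upd un ct_def o11_def)
    have 17: "runs x (out_bits [False]) (N, k t, o11) (1 + 1) (N, k t, o11 @ [False])"
      using runs_out_bits[of x "[False]" N "k t" o11] by simp
    have "o11 @ [False] = generated m p L E D D' B x"
      unfolding generated_def Let_def n_def[symmetric] w_def[symmetric] t_def[symmetric]
        cell_toks_segments[of m D D' x w, folded n_def, folded t_def]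
        o11_def o10_def o9_def o8_def o7_def o6_def o5_def o4_def o3_def o2_def o1_def
      by (simp only: append_assoc)
    moreover have "runs x prog (0, \<lambda>_. 0, []) (T n) (N, k t, o11 @ [False])"
      unfolding prog_def T_def w_def[symmetric] t_def[symmetric]
      by (rule runs_Seq[OF 1 runs_Seq[OF 2 runs_Seq[OF 3 runs_Seq[OF 4 runs_Seq[OF 5 runs_Seq[OF 6 runs_Seq[OF 7 runs_Seq[OF 8[of 0 t o3] runs_Seq[OF 9 runs_Seq[OF 10 runs_Seq[OF 11 runs_Seq[OF 12 runs_Seq[OF 13 runs_Seq[OF 14 runs_Seq[OF 15 runs_Seq[OF 18 runs_Seq[OF 16 17]]]]]]]]]]]]]]]]])
    ultimately show ?thesis by (simp only: k_def N_def n_def w_def t_def)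
  qed
  then show ?thesis
    using q by (intro polytime_computable_exec[OF bounded, of q]) (meson le_trans runs_def)
qed

section \<open>Levels for cell systems\<close>

text \<open>
  The direction of a rule points from the tested cell, which is in state \<open>nb\<close>, to the neighbour that
  changes from \<open>src\<close> to \<open>tgt\<close>. The locations of a rule are indexed by the tested cell.
\<close>

datatype 'g rule = Rule (src: 'g) (dir: bool) (nb: 'g) (tgt: 'g)

text \<open>\<open>State\<close>, \<open>CopyOn\<close> and \<open>CopyOff\<close> are doors, and
  the last three kinds carry buttons. \<open>End\<close> is the junction at which the chain of a
  state meets the gadgets of all rules that leave this state.\<close>

datatype 'g kind = State 'g | End 'g | CopyOn "'g rule" | CopyOff "'g rule" | Fire "'g rule"
  | SetCopy "'g rule" | ClearCopy "'g rule"

datatype 'g loc = Hub | Exit | At nat "'g kind"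

fun is_door :: "'g loc \<Rightarrow> bool" where
  "is_door (At i (State g)) = True"
| "is_door (At i (CopyOn r)) = True"
| "is_door (At i (CopyOff r)) = True"
| "is_door _ = False"

text \<open>Tested cells are numbered from 1, so that the subtraction never truncates.\<close>

definition nbr :: "bool \<Rightarrow> nat \<Rightarrow> nat" where
  "nbr d j = (if d then Suc j else j - 1)"

abbreviation acted :: "nat \<Rightarrow> 'g rule \<Rightarrow> nat" where
  "acted j r \<equiv> nbr (dir r) j"

lemma nbr_neq: "1 \<le> j \<Longrightarrow> nbr d j \<noteq> j"
  by (auto simp: nbr_def)

lemma nbr_inj: "1 \<le> j \<Longrightarrow> 1 \<le> j' \<Longrightarrow> nbr d j = nbr d j' \<Longrightarrow> j = j'"
  by (auto simp: nbr_def split: if_splits)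

definition set_doors :: "('l \<times> bool) list \<Rightarrow> 'l set \<Rightarrow> 'l set" where
  "set_doors acts D = (D - {d. (d, False) \<in> set acts}) \<union> {d. (d, True) \<in> set acts}"

fun button :: "nat \<Rightarrow> 'g kind \<Rightarrow> ('g loc \<times> bool) list option" where
  "button j (Fire r) = Some [(At (acted j r) (State (src r)), False), (At (acted j r) (State (tgt r)), True)]"
| "button j (SetCopy r) = Some [(At j (CopyOn r), True), (At j (CopyOff r), False)]"
| "button j (ClearCopy r) = Some [(At j (CopyOn r), False), (At j (CopyOff r), True)]"
| "button j _ = None"

text \<open>Clearing a copy is always harmless and hangs directly on the hub. Setting it lies behind
  the door of \<open>nb r\<close>, so a copy can be set only when it is true. The avatar leaves the
  firing button through the door that this button has just opened.\<close>

definition rule_edges :: "nat \<Rightarrow> 'g rule \<Rightarrow> ('g loc \<times> 'g loc) list" where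
  "rule_edges j r =
     [(Hub, At j (ClearCopy r)), (At j (State (nb r)), At j (SetCopy r)),
      (At (acted j r) (End (src r)), At j (CopyOn r)), (At j (CopyOn r), At j (Fire r)),
      (At j (Fire r), At (acted j r) (State (tgt r)))]"

lemma zip_tl:
  "(u, v) \<in> set (zip xs (tl xs)) \<longleftrightarrow> (\<exists>t. Suc t < length xs \<and> u = xs ! t \<and> v = xs ! Suc t)"
  by (cases xs) (auto simp: in_set_zip)

locale cell_system =
  fixes G :: "'g list" and Rs :: "'g rule list" and acc :: "'g \<Rightarrow> bool" and T :: nat
  assumes distinct_G: "distinct G" and distinct_Rs: "distinct Rs"
    and rules: "r \<in> set Rs \<Longrightarrow> src r \<in> set G \<and> nb r \<in> set G \<and> tgt r \<in> set G \<and> src r \<noteq> tgt r"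
begin

definition chain :: "nat \<Rightarrow> 'g \<Rightarrow> 'g loc list" where
  "chain i g = At i (State g) # map (\<lambda>r. At i (CopyOff r)) (filter (\<lambda>r. nb r = g) Rs) @ [At i (End g)]"

definition edges_at :: "nat \<Rightarrow> ('g loc \<times> 'g loc) list" where
  "edges_at j =
     map (\<lambda>g. (Hub, At j (State g))) G @
     map (\<lambda>g. (At j (State g), Exit)) (filter acc G) @
     concat (map (\<lambda>g. zip (chain j g) (tl (chain j g))) G) @
     concat (map (rule_edges j) Rs)"

text \<open>The game on symbolic locations. Correctness of the gadgets is proved here, and numbers
  enter only afterwards.\<close>

inductive walk :: "'g loc \<times> 'g loc set \<Rightarrow> 'g loc \<times> 'g loc set \<Rightarrow> bool" where
  move: "j \<in> {1..T} \<Longrightarrow> (u, v) \<in> set (edges_at j) \<or> (v, u) \<in> set (edges_at j) \<Longrightarrow>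
    is_door v \<longrightarrow> v \<in> D \<Longrightarrow> walk (u, D) (v, D)"
| press: "j \<in> {1..T} \<Longrightarrow> k \<in> Fire ` set Rs \<union> SetCopy ` set Rs \<union> ClearCopy ` set Rs \<Longrightarrow> button j k = Some acts \<Longrightarrow>
    walk (At j k, D) (At j k, set_doors acts D)"

definition cell_step :: "(nat \<Rightarrow> 'g) \<Rightarrow> (nat \<Rightarrow> 'g) \<Rightarrow> bool" where
  "cell_step cfg cfg' \<longleftrightarrow> (\<exists>j\<in>{1..T}. \<exists>r\<in>set Rs. cfg j = nb r \<and> cfg (acted j r) = src r \<and>
     cfg' = cfg(acted j r := tgt r))"

text \<open>
  After firing a rule, the avatar leaves through the door of the new state. Through this door it may
  also enter the gadget backwards, bypassing the chain; conflict-freeness makes this harmless, since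
  every rule that can be reached in this way has already the current state as its target.
\<close>

definition conflict_free :: "(nat \<Rightarrow> 'g) \<Rightarrow> bool" where
  "conflict_free cfg \<longleftrightarrow> (\<forall>j\<in>{1..T}. \<forall>j'\<in>{1..T}. \<forall>r\<in>set Rs. \<forall>r'\<in>set Rs.
     acted j r = acted j' r' \<and> src r = src r' \<and> cfg j = nb r \<and> cfg j' = nb r' \<longrightarrow> tgt r = tgt r')"

lemma distinct_chain: "distinct (chain i g)"
  using distinct_Rs by (auto simp: chain_def distinct_map inj_on_def)

lemma chain_0: "chain i g ! 0 = At i (State g)"
  by (simp add: chain_def)

lemma chain_Suc:
  assumes "Suc t < length (chain i g)"
  shows "chain i g ! Suc t \<noteq> At i (State g)"
proof -
  have "0 < length (chain i g)" using assms by linarith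
  then have "chain i g ! Suc t \<noteq> chain i g ! 0"
    using nth_eq_iff_index_eq[OF distinct_chain assms] by blast
  then show ?thesis by (simp only: chain_0 not_False_eq_True)
qed

lemma chain_last: "t < length (chain i g) \<Longrightarrow> chain i g ! t = At i (End g) \<Longrightarrow> Suc t = length (chain i g)"
  using nth_eq_iff_index_eq[OF distinct_chain, of t i g "length (chain i g) - 1"]
  by (simp add: chain_def nth_append)

lemma set_chain:
  "set (chain i g) = insert (At i (State g)) (insert (At i (End g)) {At i (CopyOff r) | r. r \<in> set Rs \<and> nb r = g})"
  by (auto simp: chain_def)

lemma chain_edges:
  "(u, v) \<in> set (zip (chain i g) (tl (chain i g))) \<longleftrightarrow>
     (\<exists>t. Suc t < length (chain i g) \<and> u = chain i g ! t \<and> v = chain i g ! Suc t)"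
  by (rule zip_tl)

subsection \<open>Soundness\<close>

text \<open>The doors from index 1 on record that the avatar has come along the chain from its
  beginning; at index 0 the condition \<open>cfg i = g\<close> stands for the state door. Reaching
  \<open>End g\<close> in this way certifies that every copy of \<open>g\<close> at cell
  \<open>i\<close> is off.\<close>

definition forward :: "'g loc set \<Rightarrow> (nat \<Rightarrow> 'g) \<Rightarrow> nat \<Rightarrow> 'g \<Rightarrow> 'g loc \<Rightarrow> bool" where
  "forward D cfg i g l \<longleftrightarrow> cfg i = g \<and> (\<exists>t<length (chain i g). l = chain i g ! t \<and>
     (\<forall>t'\<le>t. 0 < t' \<and> is_door (chain i g ! t') \<longrightarrow> chain i g ! t' \<in> D))"

text \<open>The avatar has entered the chain from its far end, by way of a gadget whose target is
  the current state. Such an avatar carries no certificate about the copies.\<close>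

definition backward :: "'g loc set \<Rightarrow> (nat \<Rightarrow> 'g) \<Rightarrow> nat \<Rightarrow> 'g \<Rightarrow> bool" where
  "backward D cfg i g \<longleftrightarrow> (\<exists>j\<in>{1..T}. \<exists>r\<in>set Rs. At j (CopyOn r) \<in> D \<and> acted j r = i \<and> src r = g \<and> cfg i = tgt r)"

definition copies_off :: "'g loc set \<Rightarrow> nat \<Rightarrow> 'g \<Rightarrow> bool" where
  "copies_off D i g \<longleftrightarrow> (\<forall>r\<in>set Rs. nb r = g \<longrightarrow> At i (CopyOff r) \<in> D)"

text \<open>The situation in which firing simulates a rule. That the tested cell is in state
  \<open>nb r\<close> follows from the copy being on.\<close>

definition ready :: "'g loc set \<Rightarrow> (nat \<Rightarrow> 'g) \<Rightarrow> nat \<Rightarrow> 'g rule \<Rightarrow> bool" where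
  "ready D cfg j r \<longleftrightarrow> cfg (acted j r) = src r \<and> copies_off D (acted j r) (src r) \<and> At j (CopyOn r) \<in> D"

fun pos_ok :: "'g loc set \<Rightarrow> (nat \<Rightarrow> 'g) \<Rightarrow> 'g loc \<Rightarrow> bool" where
  "pos_ok D cfg Hub \<longleftrightarrow> True"
| "pos_ok D cfg Exit \<longleftrightarrow> False"
| "pos_ok D cfg (At i (State g)) \<longleftrightarrow> cfg i = g"
| "pos_ok D cfg (At i (End g)) \<longleftrightarrow> forward D cfg i g (At i (End g)) \<or> backward D cfg i g"
| "pos_ok D cfg (At i (CopyOff r)) \<longleftrightarrow> forward D cfg i (nb r) (At i (CopyOff r)) \<or> backward D cfg i (nb r)"
| "pos_ok D cfg (At j (CopyOn r)) \<longleftrightarrow>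
     At j (CopyOn r) \<in> D \<and> (ready D cfg j r \<or> backward D cfg (acted j r) (src r))"
| "pos_ok D cfg (At j (Fire r)) \<longleftrightarrow> ready D cfg j r \<or> cfg (acted j r) = tgt r"
| "pos_ok D cfg (At j (SetCopy r)) \<longleftrightarrow> cfg j = nb r"
| "pos_ok D cfg (At j (ClearCopy r)) \<longleftrightarrow> True"

text \<open>Only open doors carry information: an open state door names the current state, and a
  copy that is on is true. Closed doors promise nothing.\<close>

definition invariant :: "'g loc set \<Rightarrow> (nat \<Rightarrow> 'g) \<Rightarrow> 'g loc \<Rightarrow> bool" where
  "invariant D cfg l \<longleftrightarrow> (\<forall>i g. At i (State g) \<in> D \<longrightarrow> cfg i = g) \<and>
     (\<forall>j. \<forall>r\<in>set Rs. At j (CopyOn r) \<in> D \<longrightarrow> At j (CopyOff r) \<notin> D \<and> cfg j = nb r) \<and> pos_ok D cfg l"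

lemma forward_first: "forward D cfg i g (At i (State g)) \<longleftrightarrow> cfg i = g"
  unfolding forward_def using chain_0[of i g]
  by (auto intro!: exI[of _ 0] simp: chain_def)

lemma forward_last: "forward D cfg i g (At i (End g)) \<longleftrightarrow> cfg i = g \<and> copies_off D i g"
proof
  assume "forward D cfg i g (At i (End g))"
  then obtain t where t: "cfg i = g" "t < length (chain i g)" "chain i g ! t = At i (End g)"
    and open_t: "\<forall>t'\<le>t. 0 < t' \<and> is_door (chain i g ! t') \<longrightarrow> chain i g ! t' \<in> D"
    unfolding forward_def by metis
  have len: "Suc t = length (chain i g)" by (rule chain_last) fact+
  have "At i (CopyOff r) \<in> D" if r: "r \<in> set Rs" "nb r = g" for r
  proof -
    have "At i (CopyOff r) \<in> set (chain i g)" using r by (simp add: set_chain)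
    then obtain t' where t': "t' < length (chain i g)" "chain i g ! t' = At i (CopyOff r)"
      by (metis in_set_conv_nth)
    moreover have "0 < t'" using t' chain_0[of i g] by (cases t') auto
    ultimately show ?thesis using open_t len by (metis is_door.simps(3) less_Suc_eq_le)
  qed
  then show "cfg i = g \<and> copies_off D i g" using t by (simp add: copies_off_def)
next
  assume *: "cfg i = g \<and> copies_off D i g"
  have "chain i g ! t' \<in> D" if "t' < length (chain i g)" "0 < t'" "is_door (chain i g ! t')" for t'
  proof -
    have "chain i g ! t' \<noteq> At i (State g)"
      using that nth_eq_iff_index_eq[OF distinct_chain, of t' i g 0] chain_0[of i g] by (simp add: chain_def)
    then show ?thesis
      using that nth_mem[OF that(1)] * by (auto simp: set_chain copies_off_def)
  qed
  moreover have "length (chain i g) - 1 < length (chain i g)"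
    "At i (End g) = chain i g ! (length (chain i g) - 1)"
    by (simp_all add: chain_def nth_append)
  ultimately show "forward D cfg i g (At i (End g))"
    unfolding forward_def using * by (metis le_less_trans)
qed

lemma pos_ok_chain:
  assumes "l \<in> set (chain i g)"
  shows "pos_ok D cfg l \<longleftrightarrow> forward D cfg i g l \<or> l \<noteq> At i (State g) \<and> backward D cfg i g"
  using assms by (auto simp: set_chain forward_first)

text \<open>A step towards \<open>End\<close> extends the record of open doors by the one just
  entered, and a step back shortens it. An avatar in the \<open>backward\<close> case that enters
  the state door finds it open, which yields \<open>cfg i = g\<close>, and this is all that is
  required there.\<close>

lemma chain_move:
  assumes t: "Suc t < length (chain i g)" and ok: "invariant D cfg u" and "is_door v \<longrightarrow> v \<in> D"
    and uv: "u = chain i g ! t \<and> v = chain i g ! Suc t \<or> v = chain i g ! t \<and> u = chain i g ! Suc t"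
  shows "pos_ok D cfg v"
proof -
  have mem: "u \<in> set (chain i g)" "v \<in> set (chain i g)" using t uv by (auto intro: nth_mem)
  have u: "forward D cfg i g u \<or> u \<noteq> At i (State g) \<and> backward D cfg i g"
    using ok pos_ok_chain[OF mem(1)] by (simp add: invariant_def)
  have idx: "s = s'" if "chain i g ! s = chain i g ! s'" "s < length (chain i g)" "s' < length (chain i g)" for s s'
    using that nth_eq_iff_index_eq[OF distinct_chain] by metis
  have X: "cfg i = g" if "v = At i (State g)" using that ok assms(3) by (simp add: invariant_def)
  from uv show ?thesis
  proof (elim disjE conjE)
    assume uv: "u = chain i g ! t" "v = chain i g ! Suc t"
    have "forward D cfg i g v" if fw: "forward D cfg i g u"
    proof -
      obtain s where s: "s < length (chain i g)" "u = chain i g ! s"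
        "\<forall>t'\<le>s. 0 < t' \<and> is_door (chain i g ! t') \<longrightarrow> chain i g ! t' \<in> D"
        using fw unfolding forward_def by blast
      have "s = t" using idx[of s t] s(1,2) uv t by (metis Suc_lessD)
      then have "\<forall>t'\<le>Suc t. 0 < t' \<and> is_door (chain i g ! t') \<longrightarrow> chain i g ! t' \<in> D"
        using s(3) assms(3) uv(2) unfolding le_Suc_eq by blast
      then show ?thesis using fw t uv unfolding forward_def by blast
    qed
    moreover have "v \<noteq> At i (State g)" using chain_Suc[OF t] uv by metis
    ultimately show ?thesis using u pos_ok_chain[OF mem(2)] by blast
  next
    assume uv: "v = chain i g ! t" "u = chain i g ! Suc t"
    have "forward D cfg i g v" if fw: "forward D cfg i g u"
    proof -
      obtain s where s: "s < length (chain i g)" "u = chain i g ! s"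
        "\<forall>t'\<le>s. 0 < t' \<and> is_door (chain i g ! t') \<longrightarrow> chain i g ! t' \<in> D"
        using fw unfolding forward_def by blast
      have "s = Suc t" using idx[of s "Suc t"] s(1,2) uv t by metis
      then show ?thesis using s fw t uv unfolding forward_def by (metis Suc_lessD le_SucI)
    qed
    then show ?thesis using u X pos_ok_chain[OF mem(2), of D cfg] forward_first[of D cfg i g] by metis
  qed
qed

lemma rule_move:
  assumes j: "j \<in> {1..T}" and r: "r \<in> set Rs" and ok: "invariant D cfg u" and cf: "conflict_free cfg"
    and v: "is_door v \<longrightarrow> v \<in> D"
    and uv: "(u, v) \<in> set (rule_edges j r) \<or> (v, u) \<in> set (rule_edges j r)"
  shows "pos_ok D cfg v"
proof -
  have X: "cfg i = g" if "At i (State g) \<in> D" for i g using ok that unfolding invariant_def by blast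
  have C1: "cfg j = nb r" if "At j (CopyOn r) \<in> D" "r \<in> set Rs" for j r using ok that unfolding invariant_def by blast
  have u: "pos_ok D cfg u" using ok unfolding invariant_def by blast
  have bw: "backward D cfg (acted j r) (src r)" if "cfg (acted j r) = tgt r" "At j (CopyOn r) \<in> D"
    unfolding backward_def by (intro bexI[of _ j] bexI[of _ r]) (use that j r in auto)
  \<comment> \<open>The rule used on entering backwards and the rule \<open>r\<close> now reached
    both have copies that are on and hence true, so \<open>conflict_free\<close> applies to the
    two.\<close>
  have tgt: "cfg (acted j r) = tgt r"
    if bw: "backward D cfg (acted j r) (src r)" and D: "At j (CopyOn r) \<in> D"
  proof -
    obtain j' r' where "j' \<in> {1..T}" "r' \<in> set Rs" "At j' (CopyOn r') \<in> D" "acted j' r' = acted j r"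
      "src r' = src r" "cfg (acted j r) = tgt r'"
      using bw unfolding backward_def by blast
    then show ?thesis using cf j r C1 D unfolding conflict_free_def by metis
  qed
  consider "u = Hub \<and> v = At j (ClearCopy r) \<or> v = Hub \<and> u = At j (ClearCopy r)"
    | "u = At j (State (nb r)) \<and> v = At j (SetCopy r) \<or> v = At j (State (nb r)) \<and> u = At j (SetCopy r)"
    | "u = At (acted j r) (End (src r)) \<and> v = At j (CopyOn r)"
    | "u = At j (CopyOn r) \<and> v = At (acted j r) (End (src r))"
    | "u = At j (CopyOn r) \<and> v = At j (Fire r)"
    | "u = At j (Fire r) \<and> v = At j (CopyOn r)"
    | "u = At j (Fire r) \<and> v = At (acted j r) (State (tgt r)) \<or>
       v = At j (Fire r) \<and> u = At (acted j r) (State (tgt r))"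
    using uv unfolding rule_edges_def by auto
  then show ?thesis
  proof cases
    case 7
    then show ?thesis using v X[of "acted j r" "tgt r"] u by auto
  qed (use u v bw tgt X[of j "nb r"] in \<open>auto simp: forward_last ready_def\<close>)
qed

lemma invariant_move:
  assumes j: "j \<in> {1..T}" and ok: "invariant D cfg u" and cf: "conflict_free cfg"
    and v: "is_door v \<longrightarrow> v \<in> D"
    and uv: "(u, v) \<in> set (edges_at j) \<or> (v, u) \<in> set (edges_at j)"
  shows "invariant D cfg v \<or> v = Exit \<and> acc (cfg j)"
proof -
  have X: "cfg i = g" if "At i (State g) \<in> D" for i g using ok that unfolding invariant_def by blast
  have u: "pos_ok D cfg u" using ok unfolding invariant_def by blast
  have "pos_ok D cfg v \<or> v = Exit \<and> acc (cfg j)"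
  proof -
    consider (hub) g where "u = Hub \<and> v = At j (State g) \<or> v = Hub"
      | (exit) g where "acc g" "u = At j (State g) \<and> v = Exit \<or> v = At j (State g) \<and> u = Exit"
      | (chain) g where "(u, v) \<in> set (zip (chain j g) (tl (chain j g))) \<or>
          (v, u) \<in> set (zip (chain j g) (tl (chain j g)))"
      | (rule) r where "r \<in> set Rs" "(u, v) \<in> set (rule_edges j r) \<or> (v, u) \<in> set (rule_edges j r)"
      using uv unfolding edges_at_def by auto
    then show ?thesis
    proof cases
      case hub
      then show ?thesis using X[of j g] v by auto
    next
      case exit
      then show ?thesis using u by auto
    next
      case chain
      then obtain t where "Suc t < length (chain j g)"
        "u = chain j g ! t \<and> v = chain j g ! Suc t \<or> v = chain j g ! t \<and> u = chain j g ! Suc t"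
        unfolding chain_edges by blast
      then show ?thesis using chain_move[OF _ ok v] by blast
    next
      case rule
      then show ?thesis using rule_move[OF j _ ok cf v] by blast
    qed
  qed
  then show ?thesis using ok unfolding invariant_def by blast
qed

text \<open>Only a firing button pressed in the \<open>ready\<close> case advances the cell system.
  Every other press leaves the configuration as it is, hence the reflexive closure.\<close>

lemma invariant_press:
  assumes j: "j \<in> {1..T}" and ok: "invariant D cfg (At j k)" and k: "k \<in> Fire ` set Rs \<union> SetCopy ` set Rs \<union> ClearCopy ` set Rs"
    and b: "button j k = Some acts"
  shows "\<exists>cfg'. cell_step\<^sup>=\<^sup>= cfg cfg' \<and> invariant (set_doors acts D) cfg' (At j k)"
proof -
  have X: "cfg i = g" if "At i (State g) \<in> D" for i g using ok that unfolding invariant_def by blast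
  have C1: "cfg j = nb r" "At j (CopyOff r) \<notin> D" if "At j (CopyOn r) \<in> D" "r \<in> set Rs" for j r
    using ok that unfolding invariant_def by blast+
  have u: "pos_ok D cfg (At j k)" using ok unfolding invariant_def by blast
  from k consider r where "r \<in> set Rs" "k = Fire r" | r where "r \<in> set Rs" "k = SetCopy r"
    | r where "r \<in> set Rs" "k = ClearCopy r" by blast
  then show ?thesis
  proof cases
    case (1 r)
    let ?i = "acted j r"
    let ?D = "set_doors acts D"
    have acts: "acts = [(At ?i (State (src r)), False), (At ?i (State (tgt r)), True)]"
      using b 1 by simp
    have mem: "l \<in> ?D \<longleftrightarrow> l = At ?i (State (tgt r)) \<or> l \<in> D \<and> l \<noteq> At ?i (State (src r))" for l
      unfolding acts set_doors_def by auto
    show ?thesis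
    proof (cases "cfg ?i = tgt r")
      \<comment> \<open>The cell is already in the target state, after an earlier press or a
        backward entry, so the configuration is kept.\<close>
      case True
      have "pos_ok ?D cfg (At j k)" using True 1 by simp
      moreover have "cfg i = g" if "At i (State g) \<in> ?D" for i g
        using that X[of i g] True unfolding mem by auto
      ultimately have "invariant ?D cfg (At j k)"
        unfolding invariant_def using C1 by (simp add: mem)
      then show ?thesis by blast
    next
      case False
      then have rd: "ready D cfg j r" using u 1 by simp
      then have "cfg ?i = src r" "At j (CopyOn r) \<in> D" and off: "copies_off D ?i (src r)"
        by (auto simp: ready_def)
      moreover from this have "cfg j = nb r" using C1 1 by blast
      ultimately have "cell_step cfg (cfg(?i := tgt r))"
        using j 1 unfolding cell_step_def by blast
      moreover have "invariant ?D (cfg(?i := tgt r)) (At j k)"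
      proof -
        have "pos_ok ?D (cfg(?i := tgt r)) (At j k)" using 1 by simp
        moreover have "(cfg(?i := tgt r)) i = g" if "At i (State g) \<in> ?D" for i g
          using that X[of i g] \<open>cfg ?i = src r\<close> unfolding mem by auto
        moreover have "At i (CopyOff r') \<notin> ?D \<and> (cfg(?i := tgt r)) i = nb r'"
          if "At i (CopyOn r') \<in> ?D" "r' \<in> set Rs" for i r'
        proof -
          have "At i (CopyOn r') \<in> D" using that mem by simp
          \<comment> \<open>A copy that is on at the acted cell would be a copy of its state
            \<open>src r\<close>, but the chain has shown all of these to be off.\<close>
          moreover from this have "i \<noteq> ?i"
            using C1[of i r'] off that \<open>cfg ?i = src r\<close> unfolding copies_off_def by metis
          ultimately show ?thesis using C1[of i r'] that mem by simp
        qed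
        ultimately show ?thesis unfolding invariant_def by blast
      qed
      ultimately show ?thesis by blast
    qed
  next
    case (2 r)
    then have acts: "acts = [(At j (CopyOn r), True), (At j (CopyOff r), False)]" using b by simp
    have mem: "l \<in> set_doors acts D \<longleftrightarrow> l = At j (CopyOn r) \<or> l \<in> D \<and> l \<noteq> At j (CopyOff r)" for l
      unfolding acts set_doors_def by auto
    have "pos_ok (set_doors acts D) cfg (At j k)" using 2 u by simp
    moreover have "cfg i = g" if "At i (State g) \<in> set_doors acts D" for i g
      using that X[of i g] unfolding mem by auto
    moreover have "At i (CopyOff r') \<notin> set_doors acts D \<and> cfg i = nb r'"
      if "At i (CopyOn r') \<in> set_doors acts D" "r' \<in> set Rs" for i r'
      using that C1[of i r'] u 2 unfolding mem by auto
    ultimately have "invariant (set_doors acts D) cfg (At j k)"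
      unfolding invariant_def by blast
    then show ?thesis by blast
  next
    case (3 r)
    then have acts: "acts = [(At j (CopyOn r), False), (At j (CopyOff r), True)]" using b by simp
    have mem: "l \<in> set_doors acts D \<longleftrightarrow> l = At j (CopyOff r) \<or> l \<in> D \<and> l \<noteq> At j (CopyOn r)" for l
      unfolding acts set_doors_def by auto
    have "pos_ok (set_doors acts D) cfg (At j k)" using 3 by simp
    moreover have "cfg i = g" if "At i (State g) \<in> set_doors acts D" for i g
      using that X[of i g] unfolding mem by auto
    moreover have "At i (CopyOff r') \<notin> set_doors acts D \<and> cfg i = nb r'"
      if "At i (CopyOn r') \<in> set_doors acts D" "r' \<in> set Rs" for i r'
      using that C1[of i r'] 3 unfolding mem by auto
    ultimately have "invariant (set_doors acts D) cfg (At j k)"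
      unfolding invariant_def by blast
    then show ?thesis by blast
  qed
qed

subsection \<open>Completeness\<close>

text \<open>The standard position of the doors between two simulated steps. Cells \<open>0\<close>
  and \<open>T + 1\<close> occur because they are neighbours of tested cells.\<close>

definition door_state :: "(nat \<Rightarrow> 'g) \<Rightarrow> 'g loc set" where
  "door_state cfg = {At i (State (cfg i)) | i. i < T + 2} \<union> {At i (CopyOff r) | i r. i < T + 2 \<and> r \<in> set Rs}"

lemma invariant_door_state: "invariant (door_state cfg) cfg Hub"
  by (auto simp: invariant_def door_state_def)

text \<open>The first alternative is permanent. It covers whatever the avatar does after entering
  the exit, where the invariant fails.\<close>

lemma walk_sound:
  assumes cf: "\<And>cfg'. cell_step\<^sup>*\<^sup>* cfg cfg' \<Longrightarrow> conflict_free cfg'"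
    and "walk\<^sup>*\<^sup>* (Hub, door_state cfg) s"
  shows "(\<exists>cfg'. cell_step\<^sup>*\<^sup>* cfg cfg' \<and> (\<exists>i\<in>{1..T}. acc (cfg' i))) \<or>
    (\<exists>cfg'. cell_step\<^sup>*\<^sup>* cfg cfg' \<and> invariant (snd s) cfg' (fst s))"
  using assms(2)
proof (induction rule: rtranclp_induct)
  case base
  show ?case using invariant_door_state by auto
next
  case (step s s')
  show ?case
  proof (cases "\<exists>cfg'. cell_step\<^sup>*\<^sup>* cfg cfg' \<and> (\<exists>i\<in>{1..T}. acc (cfg' i))")
    case False
    then obtain cfg' where c: "cell_step\<^sup>*\<^sup>* cfg cfg'" "invariant (snd s) cfg' (fst s)"
      using step.IH by blast
    from step.hyps(2) show ?thesis
    proof cases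
      case (move j u v D)
      then have "invariant D cfg' u" using c(2) by simp
      from invariant_move[OF move(3) this cf[OF c(1)] move(5,4)] show ?thesis using c(1) move(2,3) by auto
    next
      case (press j k acts D)
      then have "invariant D cfg' (At j k)" using c(2) by simp
      from invariant_press[OF press(3) this press(4,5)] obtain cfg''
        where cs: "cell_step\<^sup>=\<^sup>= cfg' cfg''" and "invariant (set_doors acts D) cfg'' (At j k)" by blast
      moreover have "cell_step\<^sup>*\<^sup>* cfg cfg''"
        using c(1) cs by (auto intro: rtranclp.rtrancl_into_rtrancl)
      ultimately show ?thesis using press(2) by auto
    qed
  qed blast
qed

lemma walk_move: "j \<in> {1..T} \<Longrightarrow> (u, v) \<in> set (edges_at j) \<Longrightarrow> is_door v \<longrightarrow> v \<in> D \<Longrightarrow> walk (u, D) (v, D)"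
  by (rule walk.move) auto

lemma walk_move': "j \<in> {1..T} \<Longrightarrow> (v, u) \<in> set (edges_at j) \<Longrightarrow> is_door v \<longrightarrow> v \<in> D \<Longrightarrow> walk (u, D) (v, D)"
  by (rule walk.move) auto

lemma walk_chain:
  assumes i: "i \<in> {1..T}" "g \<in> set G" and off: "copies_off D i g"
  shows "walk\<^sup>*\<^sup>* (At i (State g), D) (At i (End g), D)"
proof -
  have "t < length (chain i g) \<Longrightarrow> walk\<^sup>*\<^sup>* (At i (State g), D) (chain i g ! t, D)" for t
  proof (induction t)
    case 0
    then show ?case by (simp add: chain_0)
  next
    case (Suc t)
    have "(chain i g ! t, chain i g ! Suc t) \<in> set (edges_at i)"
      using i Suc.prems chain_edges[of "chain i g ! t" "chain i g ! Suc t" i g]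
      unfolding edges_at_def by auto
    moreover have "is_door (chain i g ! Suc t) \<longrightarrow> chain i g ! Suc t \<in> D"
      using chain_Suc[OF Suc.prems] nth_mem[OF Suc.prems] off by (auto simp: set_chain copies_off_def)
    ultimately show ?case using Suc walk_move[OF i(1)] by (metis Suc_lessD rtranclp.rtrancl_into_rtrancl)
  qed
  from this[of "length (chain i g) - 1"] show ?thesis
    by (simp add: chain_def nth_append)
qed

text \<open>The copy is cleared at the end, which restores the standard position and lets simulated
  steps be composed. The acted cell has to be an inner cell, since only those are joined to the
  hub.\<close>

lemma walk_cell_step:
  assumes j: "j \<in> {1..T}" "acted j r \<in> {1..T}" and r: "r \<in> set Rs"
    and nb: "cfg j = nb r" and src: "cfg (acted j r) = src r"
  shows "walk\<^sup>*\<^sup>* (Hub, door_state cfg) (Hub, door_state (cfg(acted j r := tgt r)))"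
proof -
  let ?i = "acted j r"
  let ?cfg' = "cfg(?i := tgt r)"
  define D0 where "D0 = door_state cfg"
  define D1 where "D1 = set_doors [(At j (CopyOn r), True), (At j (CopyOff r), False)] D0"
  define D2 where "D2 = set_doors [(At ?i (State (src r)), False), (At ?i (State (tgt r)), True)] D1"
  define D3 where "D3 = set_doors [(At j (CopyOn r), False), (At j (CopyOff r), True)] D2"
  have G: "src r \<in> set G" "nb r \<in> set G" "tgt r \<in> set G" using rules[OF r] by auto
  have ij: "?i \<noteq> j" using j nbr_neq by auto
  have X0: "At i (State (cfg i)) \<in> D0" if "i \<in> {1..T}" for i
    using that by (simp add: D0_def door_state_def)
  have X1: "At i (State (cfg i)) \<in> D1" if "i \<in> {1..T}" for i
    using X0[OF that] by (auto simp: D1_def set_doors_def)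
  have e: "e \<in> set (rule_edges j r) \<Longrightarrow> e \<in> set (edges_at j)" for e
    using r unfolding edges_at_def by auto
  have hub: "(Hub, At i (State g)) \<in> set (edges_at i)" if "g \<in> set G" for i g
    using that unfolding edges_at_def by auto
  \<comment> \<open>The one copy that is on belongs to cell \<open>j\<close>, which differs from the
    acted cell.\<close>
  have off: "copies_off D1 ?i (src r)"
    using j ij by (auto simp: copies_off_def D1_def D0_def set_doors_def door_state_def)
  have "walk\<^sup>*\<^sup>* (Hub, D0) (At j (State (nb r)), D0)"
    using walk_move[OF j(1) hub[OF G(2)]] X0[OF j(1)] nb by (simp add: r_into_rtranclp)
  also have "walk (At j (State (nb r)), D0) (At j (SetCopy r), D0)"
    using walk_move[OF j(1) e] by (simp add: rule_edges_def)
  also have "walk (At j (SetCopy r), D0) (At j (SetCopy r), D1)"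
    unfolding D1_def using walk.press[OF j(1), of "SetCopy r"] r by simp
  also have "walk (At j (SetCopy r), D1) (At j (State (nb r)), D1)"
    using walk_move'[OF j(1) e] X1[OF j(1)] nb by (simp add: rule_edges_def)
  also have "walk (At j (State (nb r)), D1) (Hub, D1)"
    using walk_move'[OF j(1) hub[OF G(2)]] by simp
  also have "walk (Hub, D1) (At ?i (State (src r)), D1)"
    using walk_move[OF j(2) hub[OF G(1)]] X1[OF j(2)] src by simp
  also have "walk\<^sup>*\<^sup>* (At ?i (State (src r)), D1) (At ?i (End (src r)), D1)"
    by (rule walk_chain[OF j(2) G(1) off])
  also have "walk (At ?i (End (src r)), D1) (At j (CopyOn r), D1)"
    using walk_move[OF j(1) e] by (simp add: rule_edges_def D1_def set_doors_def)
  also have "walk (At j (CopyOn r), D1) (At j (Fire r), D1)"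
    using walk_move[OF j(1) e] by (simp add: rule_edges_def)
  also have "walk (At j (Fire r), D1) (At j (Fire r), D2)"
    unfolding D2_def using walk.press[OF j(1), of "Fire r"] r by simp
  also have "walk (At j (Fire r), D2) (At ?i (State (tgt r)), D2)"
    using walk_move[OF j(1) e] by (simp add: rule_edges_def D2_def set_doors_def)
  also have "walk (At ?i (State (tgt r)), D2) (Hub, D2)"
    using walk_move'[OF j(2) hub[OF G(3)]] by simp
  also have "walk (Hub, D2) (At j (ClearCopy r), D2)"
    using walk_move[OF j(1) e] by (simp add: rule_edges_def)
  also have "walk (At j (ClearCopy r), D2) (At j (ClearCopy r), D3)"
    unfolding D3_def using walk.press[OF j(1), of "ClearCopy r"] r by simp
  also have "walk (At j (ClearCopy r), D3) (Hub, D3)"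
    using walk_move'[OF j(1) e] by (simp add: rule_edges_def)
  finally have "walk\<^sup>*\<^sup>* (Hub, D0) (Hub, D3)" by simp
  moreover have "D3 = door_state ?cfg'"
  proof (rule set_eqI)
    fix l
    show "l \<in> D3 \<longleftrightarrow> l \<in> door_state ?cfg'"
    proof (cases l)
      case (At i k)
      show ?thesis
        using j r src rules[OF r] unfolding At
        by (cases k) (auto simp: D3_def D2_def D1_def D0_def set_doors_def door_state_def)
    qed (auto simp: D3_def D2_def D1_def D0_def set_doors_def door_state_def)
  qed
  ultimately show ?thesis by (simp add: D0_def)
qed

lemma walk_exit:
  assumes "j \<in> {1..T}" "acc (cfg j)" "cfg j \<in> set G"
  shows "walk\<^sup>*\<^sup>* (Hub, door_state cfg) (Exit, door_state cfg)"
proof -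
  have "walk\<^sup>*\<^sup>* (Hub, door_state cfg) (At j (State (cfg j)), door_state cfg)"
    using assms by (intro r_into_rtranclp walk_move[of j]) (auto simp: edges_at_def door_state_def)
  also have "walk (At j (State (cfg j)), door_state cfg) (Exit, door_state cfg)"
    using assms by (intro walk_move[of j]) (auto simp: edges_at_def)
  finally show ?thesis by simp
qed

end

section \<open>Doors and buttons of the symbolic level\<close>

lemma mem_apfst_image: "(d, b) \<in> apfst f ` S \<longleftrightarrow> (\<exists>l. (l, b) \<in> S \<and> d = f l)"
proof
  assume "(d, b) \<in> apfst f ` S"
  then show "\<exists>l. (l, b) \<in> S \<and> d = f l" by auto
next
  assume "\<exists>l. (l, b) \<in> S \<and> d = f l"
  then obtain l where "(l, b) \<in> S" "d = f l" by blast
  then show "(d, b) \<in> apfst f ` S" by (intro image_eqI[of _ _ "(l, b)"]) simp_all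
qed

context cell_system
begin

definition kinds :: "'g kind set" where
  "kinds = State ` set G \<union> End ` set G \<union> CopyOn ` set Rs \<union> CopyOff ` set Rs \<union> Fire ` set Rs \<union> SetCopy ` set Rs \<union> ClearCopy ` set Rs"

lemma finite_kinds: "finite kinds"
  by (simp add: kinds_def)

fun valid :: "'g loc \<Rightarrow> bool" where
  "valid (At i k) \<longleftrightarrow> i < T + 2 \<and> k \<in> kinds"
| "valid _ \<longleftrightarrow> True"

definition doors_at :: "nat \<Rightarrow> 'g \<Rightarrow> ('g loc \<times> bool) list" where
  "doors_at i g = map (\<lambda>h. (At i (State h), h = g)) G @
     map (\<lambda>r. (At i (CopyOn r), False)) Rs @ map (\<lambda>r. (At i (CopyOff r), True)) Rs"

definition buttons_at :: "nat \<Rightarrow> ('g loc \<times> ('g loc \<times> bool) list) list" where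
  "buttons_at j = concat (map (\<lambda>r. map (\<lambda>k. (At j k, the (button j k))) [Fire r, SetCopy r, ClearCopy r]) Rs)"

lemma valid_edges:
  assumes "j \<in> {1..T}" "(u, v) \<in> set (edges_at j)"
  shows "valid u \<and> valid v"
proof -
  have nbr: "nbr d j < T + 2" for d using assms(1) by (auto simp: nbr_def)
  have chain: "valid l" if "l \<in> set (chain j g)" "g \<in> set G" for l g
    using that assms(1) by (auto simp: set_chain kinds_def)
  have zip: "(u, v) \<in> set (zip xs (tl xs)) \<Longrightarrow> u \<in> set xs \<and> v \<in> set xs" for xs
    by (cases xs) (auto dest: set_zip_leftD set_zip_rightD)
  consider "(u, v) \<in> (\<lambda>g. (Hub, At j (State g))) ` set G \<union> (\<lambda>g. (At j (State g), Exit)) ` set G"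
    | g where "g \<in> set G" "(u, v) \<in> set (zip (chain j g) (tl (chain j g)))"
    | r where "r \<in> set Rs" "(u, v) \<in> set (rule_edges j r)"
    using assms(2) unfolding edges_at_def by auto
  then show ?thesis
  proof cases
    case 1
    then show ?thesis using assms(1) by (auto simp: kinds_def)
  next
    case 2
    then show ?thesis using zip chain by blast
  next
    case 3
    then show ?thesis
      using assms(1) nbr rules[OF 3(1)] by (auto simp: rule_edges_def kinds_def)
  qed
qed

lemma set_buttons_at:
  "(l, acts) \<in> set (buttons_at j) \<longleftrightarrow>
     (\<exists>k\<in>Fire ` set Rs \<union> SetCopy ` set Rs \<union> ClearCopy ` set Rs. l = At j k \<and> button j k = Some acts)"
  by (auto simp: buttons_at_def)

lemma valid_buttons:
  assumes "j \<in> {1..T}" "(l, acts) \<in> set (buttons_at j)"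
  shows "valid l \<and> (\<forall>(d, b)\<in>set acts. valid d \<and> is_door d) \<and> distinct (map fst acts) \<and> length acts = 2"
proof -
  have nbr: "nbr d j < T + 2" for d using assms(1) by (auto simp: nbr_def)
  show ?thesis
    using assms nbr rules unfolding set_buttons_at by (auto simp: kinds_def)
qed

text \<open>The lists of different cells cannot clash because \<open>At\<close> carries the
  cell.\<close>

lemma distinct_concat_at:
  assumes F: "\<And>j. distinct (map fst (F j))" "\<And>j b. b \<in> set (F j) \<Longrightarrow> fst b \<in> range (At j)"
    and "distinct js"
  shows "distinct (map fst (concat (map F js)))"
  using assms(3)
proof (induction js)
  case (Cons j js)
  have "l \<notin> fst ` set (concat (map F js))" if l: "l \<in> fst ` set (F j)" for l
  proof
    assume "l \<in> fst ` set (concat (map F js))"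
    then obtain j' b' where b': "j' \<in> set js" "b' \<in> set (F j')" "l = fst b'" by auto
    obtain b where b: "b \<in> set (F j)" "l = fst b" using l by blast
    have "l \<in> range (At j)" "l \<in> range (At j')" using F(2)[OF b(1)] F(2)[OF b'(2)] b b' by simp_all
    then show False using Cons.prems b'(1) by auto
  qed
  then have "fst ` set (F j) \<inter> fst ` set (concat (map F js)) = {}" by blast
  moreover have "distinct (map fst (concat (map F js)))" using Cons by simp
  ultimately show ?case using F(1)[of j] by (simp del: set_concat)
qed simp

lemma distinct_concat_buttons: "distinct (map fst (concat (map buttons_at [1..<Suc T])))"
proof (rule distinct_concat_at)
  fix j
  have "distinct (concat (map (\<lambda>r. [At j (Fire r), At j (SetCopy r), At j (ClearCopy r)]) xs))" if "distinct xs" for xs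
    using that by (induction xs) auto
  moreover have "map fst (buttons_at j) = concat (map (\<lambda>r. [At j (Fire r), At j (SetCopy r), At j (ClearCopy r)]) Rs)"
    by (simp add: buttons_at_def map_concat o_def)
  ultimately show "distinct (map fst (buttons_at j))" using distinct_Rs by simp
  show "fst b \<in> range (At j)" if "b \<in> set (buttons_at j)" for b
    using that set_buttons_at[of "fst b" "snd b" j] by auto
qed simp

lemma fst_doors_at: "fst ` set (doors_at i g) = At i ` (State ` set G \<union> CopyOn ` set Rs \<union> CopyOff ` set Rs)"
  by (auto simp: doors_at_def image_Un image_image)

lemma distinct_concat_doors: "distinct (map fst (concat (map (\<lambda>i. doors_at i (cfg i)) [0..<T + 2])))"
proof (rule distinct_concat_at)
  fix i
  show "distinct (map fst (doors_at i (cfg i)))"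
    using distinct_G distinct_Rs by (auto simp: doors_at_def distinct_map inj_on_def o_def)
  show "fst b \<in> range (At i)" if "b \<in> set (doors_at i (cfg i))" for b
    using that fst_doors_at[of i "cfg i"] by blast
qed simp

lemma is_door_iff:
  "valid l \<and> is_door l \<longleftrightarrow> (\<exists>i<T + 2. l \<in> fst ` set (doors_at i (cfg i)))"
proof (cases l)
  case (At i k)
  show ?thesis unfolding At fst_doors_at by (cases k) (auto simp: kinds_def)
qed (auto simp: fst_doors_at)

lemma fst_doors:
  "fst ` set (concat (map (\<lambda>i. doors_at i (cfg i)) [0..<T + 2])) = {l. valid l \<and> is_door l}"
  unfolding is_door_iff[of _ cfg] set_concat set_map set_upt image_UN by auto

end

section \<open>Numbering the locations\<close>

locale numbered_cell_system = cell_system +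
  fixes e :: "'a kind \<Rightarrow> nat" and m :: nat
  assumes inj_e: "inj_on e kinds" and e_less: "k \<in> kinds \<Longrightarrow> e k < m"
begin

text \<open>Each cell owns a block of \<open>m\<close> consecutive numbers. This makes the number of
  a location affine in the cell with slope \<open>m\<close>, which is what a \<open>Rep\<close>
  token can write.\<close>

fun num :: "'a loc \<Rightarrow> nat" where
  "num Hub = 0"
| "num Exit = 1"
| "num (At i k) = 2 + i * m + e k"

lemma num_less: "valid l \<Longrightarrow> num l < (T + 2) * m + 2"
proof (induction l rule: valid.induct)
  case (1 i k)
  then have "e k < m" "i + 1 \<le> T + 2" using e_less by auto
  then have "i * m + e k < (i + 1) * m" "(i + 1) * m \<le> (T + 2) * m"
    by (simp, intro mult_le_mono1)
  then show ?case by simp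
qed auto

text \<open>As \<open>e k < m\<close>, division by \<open>m\<close> recovers the cell, and what
  remains determines the kind.\<close>

lemma num_inj:
  assumes "valid l" "valid l'" "num l = num l'"
  shows "l = l'"
proof (cases l; cases l')
  fix i k i' k'
  assume l: "l = At i k" "l' = At i' k'"
  then have k: "k \<in> kinds" "k' \<in> kinds" and eq: "i * m + e k = i' * m + e k'"
    using assms by auto
  have "(i * m + e k) div m = i" "(i' * m + e k') div m = i'"
    using e_less[OF k(1)] e_less[OF k(2)] by simp_all
  then have "i = i'" using eq by simp
  moreover have "e k = e k'" using eq \<open>i = i'\<close> by simp
  ultimately show "l = l'" using k inj_e l by (auto dest: inj_onD)
qed (use assms in auto)

lemma image_num_iff: "valid d \<Longrightarrow> B \<subseteq> Collect valid \<Longrightarrow> num d \<in> num ` B \<longleftrightarrow> d \<in> B"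
  by (rule inj_on_image_mem_iff[of _ "Collect valid"]) (auto intro: inj_onI num_inj)

text \<open>Gadgets are indexed by tested cells \<open>1\<close> to \<open>T\<close>; the doors
  range over \<open>0\<close> to \<open>T + 1\<close> because gadgets also act on the
  neighbours.\<close>

definition game :: "(nat \<Rightarrow> 'a) \<Rightarrow> level" where
  "game cfg = \<lparr>num_locs = (T + 2) * m + 2,
     edges = map (map_prod num num) (concat (map edges_at [1..<Suc T])),
     start_loc = 0, exit_loc = 1,
     doors = map (apfst num) (concat (map (\<lambda>i. doors_at i (cfg i)) [0..<T + 2])),
     buttons = map (map_prod num (map (apfst num))) (concat (map buttons_at [1..<Suc T]))\<rparr>"

lemma game_ends: "start_loc (game cfg) = num Hub" "exit_loc (game cfg) = num Exit"
  by (simp_all add: game_def)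

lemma edges_game:
  "(p, q) \<in> set (edges (game cfg)) \<longleftrightarrow>
     (\<exists>j\<in>{1..T}. \<exists>u v. (u, v) \<in> set (edges_at j) \<and> p = num u \<and> q = num v)"
proof -
  have *: "(p, q) \<in> map_prod num num ` S \<longleftrightarrow> (\<exists>u v. (u, v) \<in> S \<and> p = num u \<and> q = num v)" for S
    by (auto simp: image_def) (blast, metis map_prod_simp)
  have "set (edges (game cfg)) = map_prod num num ` (\<Union>j\<in>{1..T}. set (edges_at j))"
    unfolding game_def by (simp add: image_UN atLeastLessThanSuc_atLeastAtMost del: upt_Suc)
  then show ?thesis by (simp only: * UN_iff) blast
qed

lemma buttons_game:
  "(p, acts) \<in> set (buttons (game cfg)) \<longleftrightarrow>
     (\<exists>j\<in>{1..T}. \<exists>l acts'. (l, acts') \<in> set (buttons_at j) \<and> p = num l \<and> acts = map (apfst num) acts')"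
proof -
  have *: "(p, acts) \<in> map_prod num (map (apfst num)) ` S \<longleftrightarrow>
      (\<exists>l acts'. (l, acts') \<in> S \<and> p = num l \<and> acts = map (apfst num) acts')" for S
    by (auto simp: image_def) (blast, metis map_prod_simp)
  have "set (buttons (game cfg)) = map_prod num (map (apfst num)) ` (\<Union>j\<in>{1..T}. set (buttons_at j))"
    unfolding game_def by (simp add: image_UN atLeastLessThanSuc_atLeastAtMost del: upt_Suc)
  then show ?thesis by (simp only: * UN_iff) blast
qed

lemma distinct_map_num: "(\<And>l. l \<in> set ls \<Longrightarrow> valid l) \<Longrightarrow> distinct ls \<Longrightarrow> distinct (map num ls)"
  by (auto simp: distinct_map intro!: inj_onI num_inj)

lemma door_locs_game: "door_locs (game cfg) = num ` {l. valid l \<and> is_door l}"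
proof -
  let ?ds = "concat (map (\<lambda>i. doors_at i (cfg i)) [0..<T + 2])"
  have "fst ` set ?ds = {l. valid l \<and> is_door l}" by (rule fst_doors)
  moreover have "door_locs (game cfg) = num ` fst ` set ?ds"
    unfolding door_locs_def game_def by (simp only: level.simps set_map image_image fst_apfst)
  ultimately show ?thesis by simp
qed

lemma wf_game: "wf_level 2 (game cfg)"
proof -
  have doors: "distinct (map fst (doors (game cfg)))"
  proof -
    have "map fst (doors (game cfg)) = map num (map fst (concat (map (\<lambda>i. doors_at i (cfg i)) [0..<T + 2])))"
      by (simp add: game_def del: map_concat upt_Suc)
    moreover have "valid l" if "l \<in> set (map fst (concat (map (\<lambda>i. doors_at i (cfg i)) [0..<T + 2])))" for l
      using that fst_doors[of cfg] unfolding set_map by blast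
    ultimately show ?thesis using distinct_map_num distinct_concat_doors by metis
  qed
  have buttons: "distinct (map fst (buttons (game cfg)))"
  proof -
    have "map fst (buttons (game cfg)) = map num (map fst (concat (map buttons_at [1..<Suc T])))"
      by (simp add: game_def del: map_concat upt_Suc)
    moreover have "valid l" if l: "l \<in> set (map fst (concat (map buttons_at [1..<Suc T])))" for l
    proof -
      obtain j b where j: "j \<in> set [1..<Suc T]" and b: "b \<in> set (buttons_at j)" "l = fst b"
        using l unfolding set_map set_concat by blast
      have "j \<in> {1..T}" using j by (simp del: upt_Suc add: less_Suc_eq_le)
      moreover have "(l, snd b) \<in> set (buttons_at j)" using b by simp
      ultimately show ?thesis using valid_buttons by blast
    qed
    ultimately show ?thesis using distinct_map_num distinct_concat_buttons by metis
  qed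
  have e: "u < num_locs (game cfg) \<and> v < num_locs (game cfg)" if uv: "(u, v) \<in> set (edges (game cfg))" for u v
  proof -
    obtain j u' v' where j: "j \<in> {1..T}" "(u', v') \<in> set (edges_at j)" and "u = num u'" "v = num v'"
      using uv unfolding edges_game by blast
    then show ?thesis using valid_edges[OF j] num_less by (simp add: game_def)
  qed
  have b: "b < num_locs (game cfg) \<and> length acts \<le> 2 \<and> distinct (map fst acts) \<and>
      fst ` set acts \<subseteq> door_locs (game cfg)" if ba: "(b, acts) \<in> set (buttons (game cfg))" for b acts
  proof -
    obtain j l acts' where j: "j \<in> {1..T}" "(l, acts') \<in> set (buttons_at j)"
      and eq: "b = num l" "acts = map (apfst num) acts'"
      using ba unfolding buttons_game by blast
    note v = valid_buttons[OF j]
    have "distinct (map num (map fst acts'))"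
      using v by (intro distinct_map_num) auto
    moreover have "b < num_locs (game cfg)" using v num_less eq by (simp add: game_def)
    moreover have "fst ` set acts \<subseteq> door_locs (game cfg)"
      using v eq by (auto simp: door_locs_game)
    ultimately show ?thesis using v eq by simp
  qed
  have "d < num_locs (game cfg)" if "d \<in> door_locs (game cfg)" for d
    using that num_less by (auto simp: door_locs_game) (simp add: game_def)
  moreover have "start_loc (game cfg) < num_locs (game cfg)" "exit_loc (game cfg) < num_locs (game cfg)"
    by (auto simp: game_def)
  ultimately show ?thesis
    unfolding wf_level_def using doors buttons e b by blast
qed

definition locs_of :: "nat set \<Rightarrow> 'a loc set" where
  "locs_of D = {l. valid l \<and> num l \<in> D}"

lemma mem_acts:
  assumes "\<forall>(d, c)\<in>set acts. valid d \<and> is_door d" "valid d"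
  shows "(num d, c) \<in> set (map (apfst num) acts) \<longleftrightarrow> (d, c) \<in> set acts"
proof
  assume "(num d, c) \<in> set (map (apfst num) acts)"
  then obtain d' where d': "(d', c) \<in> set acts" "num d = num d'" by auto
  then have "valid d'" using assms(1) by blast
  then show "(d, c) \<in> set acts" using d' num_inj[OF assms(2)] by blast
qed force

text \<open>Injectivity undoes the numbering: the number of the position determines the location,
  and a press acts on the preimage of the open doors as it does on numbers.\<close>

lemma walk_of_level_step:
  assumes "level_step (game cfg) (num l, D) s" "valid l"
  shows "\<exists>l' D'. s = (num l', D') \<and> valid l' \<and> walk (l, locs_of D) (l', locs_of D')"
  using assms(1)
proof cases
  case (move v)
  then obtain j u' v' where j: "j \<in> {1..T}" and uv: "(u', v') \<in> set (edges_at j) \<or> (v', u') \<in> set (edges_at j)"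
    and num: "num l = num u'" "v = num v'"
    unfolding adjacent_def edges_game by metis
  have val: "valid u'" "valid v'" using uv valid_edges[OF j] by auto
  have "l = u'" using num_inj[OF assms(2) val(1) num(1)] .
  moreover have "is_door v' \<longrightarrow> v' \<in> locs_of D"
    using move val num by (auto simp: door_locs_game locs_of_def)
  ultimately have "walk (l, locs_of D) (v', locs_of D)"
    using walk.move[OF j] uv by blast
  then show ?thesis using move num val by blast
next
  case (press acts)
  then obtain j l' acts' where j: "j \<in> {1..T}" and b: "(l', acts') \<in> set (buttons_at j)"
    and eq: "num l = num l'" "acts = map (apfst num) acts'"
    unfolding buttons_game by blast
  note v = valid_buttons[OF j b]
  have l: "l = l'" using num_inj[OF assms(2) _ eq(1)] v by blast
  have mem: "(num d, c) \<in> set acts \<longleftrightarrow> (d, c) \<in> set acts'" if "valid d" for d c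
    using mem_acts[of acts' d c] v that unfolding eq by blast
  have "valid d" if "(d, c) \<in> set acts'" for d c using that v by blast
  then have "locs_of (Defs.press acts D) = set_doors acts' (locs_of D)"
    using mem unfolding locs_of_def Defs.press_def set_doors_def by blast
  moreover obtain k where "k \<in> Fire ` set Rs \<union> SetCopy ` set Rs \<union> ClearCopy ` set Rs" "l' = At j k" "button j k = Some acts'"
    using b unfolding set_buttons_at by blast
  ultimately have "walk (l, locs_of D) (l, locs_of (Defs.press acts D))"
    using walk.press[OF j] l by metis
  then show ?thesis using press assms(2) by blast
qed

lemma level_step_of_walk:
  assumes "walk (l, A) (l', A')" "A \<subseteq> Collect valid" "valid l"
  shows "level_step (game cfg) (num l, num ` A) (num l', num ` A') \<and> A' \<subseteq> Collect valid \<and> valid l'"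
  using assms(1)
proof cases
  case (move j)
  have val: "valid l'" using move valid_edges by blast
  have "adjacent (game cfg) (num l) (num l')"
    unfolding adjacent_def edges_game using move by blast
  moreover have "is_door l'" if "num l' \<in> door_locs (game cfg)"
    using that num_inj[OF val] unfolding door_locs_game by blast
  ultimately show ?thesis using move assms val by (auto intro!: level_step.move)
next
  case (press j k acts)
  then have b: "(l, acts) \<in> set (buttons_at j)" by (auto simp: set_buttons_at)
  note v = valid_buttons[OF press(4) b]
  have "(num l, map (apfst num) acts) \<in> set (buttons (game cfg))"
    unfolding buttons_game using b press(4) by blast
  moreover have "num ` A' = Defs.press (map (apfst num) acts) (num ` A)"
  proof -
    have mem: "(num d, c) \<in> set (map (apfst num) acts) \<longleftrightarrow> (d, c) \<in> set acts" if "valid d" for d c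
      using mem_acts[of acts d c] v that by blast
    have valid_acts: "valid d" if "(d, c) \<in> set acts" for d c using that v by blast
    have "num ` set_doors acts A = Defs.press (map (apfst num) acts) (num ` A)"
    proof (rule set_eqI)
      fix n
      show "n \<in> num ` set_doors acts A \<longleftrightarrow> n \<in> Defs.press (map (apfst num) acts) (num ` A)"
      proof (cases "\<exists>d. valid d \<and> n = num d")
        case True
        then obtain d where d: "valid d" "n = num d" by blast
        have img: "n \<in> num ` B \<longleftrightarrow> d \<in> B" if "B \<subseteq> Collect valid" for B
          using image_num_iff[OF d(1) that] d(2) by simp
        have "set_doors acts A \<subseteq> Collect valid"
          using assms(2) valid_acts unfolding set_doors_def by blast
        then have "n \<in> num ` set_doors acts A \<longleftrightarrow> d \<in> set_doors acts A" using img by blast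
        also have "\<dots> \<longleftrightarrow> n \<in> Defs.press (map (apfst num) acts) (num ` A)"
          using mem[OF d(1)] img[OF assms(2)] d(2) by (simp add: Defs.press_def set_doors_def)
        finally show ?thesis .
      next
        \<comment> \<open>A number that belongs to no valid location lies in neither set, as both
          arise from valid locations.\<close>
        case False
        have "set_doors acts A \<subseteq> Collect valid"
          using assms(2) valid_acts unfolding set_doors_def by blast
        then have "n \<notin> num ` set_doors acts A" using False by blast
        moreover have "n \<notin> num ` A" using False assms(2) by blast
        moreover have "(n, True) \<notin> set (map (apfst num) acts)" using False valid_acts by auto
        ultimately show ?thesis by (simp add: Defs.press_def)
      qed
    qed
    then show ?thesis using press by simp
  qed
  ultimately have "level_step (game cfg) (num l, num ` A) (num l, num ` A')"
    using level_step.press by metis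
  moreover have "A' \<subseteq> Collect valid"
    using press(2) assms(2) v unfolding set_doors_def press by blast
  ultimately show ?thesis using press assms(3) by simp
qed

lemma door_state_valid:
  assumes "\<And>i. i < T + 2 \<Longrightarrow> cfg i \<in> set G"
  shows "door_state cfg \<subseteq> Collect valid"
  using assms by (auto simp: door_state_def kinds_def)

lemma initially_open:
  assumes "\<And>i. i < T + 2 \<Longrightarrow> cfg i \<in> set G"
  shows "{d. (d, True) \<in> set (doors (game cfg))} = num ` door_state cfg"
proof -
  have "(l, True) \<in> set (concat (map (\<lambda>i. doors_at i (cfg i)) [0..<T + 2])) \<longleftrightarrow> l \<in> door_state cfg" for l
  proof -
    have "(l, True) \<in> set (doors_at i (cfg i)) \<longleftrightarrow>
        l = At i (State (cfg i)) \<or> (\<exists>r\<in>set Rs. l = At i (CopyOff r))" if "i < T + 2" for i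
      using assms[OF that] by (auto simp: doors_at_def)
    moreover have "(l, True) \<in> set (concat (map (\<lambda>i. doors_at i (cfg i)) [0..<T + 2])) \<longleftrightarrow>
        (\<exists>i<T + 2. (l, True) \<in> set (doors_at i (cfg i)))"
      unfolding set_concat set_map set_upt by auto
    ultimately show ?thesis unfolding door_state_def by blast
  qed
  moreover have "(d, True) \<in> set (doors (game cfg)) \<longleftrightarrow>
      (\<exists>l. (l, True) \<in> set (concat (map (\<lambda>i. doors_at i (cfg i)) [0..<T + 2])) \<and> d = num l)" for d
  proof -
    have "set (doors (game cfg)) = apfst num ` set (concat (map (\<lambda>i. doors_at i (cfg i)) [0..<T + 2]))"
      unfolding game_def by (simp only: level.simps set_map)
    then show ?thesis by (simp only: mem_apfst_image)
  qed
  ultimately show ?thesis by blast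
qed

lemma walk_of_level_steps:
  assumes "(level_step (game cfg))\<^sup>*\<^sup>* (num l, D) s" "valid l"
  shows "\<exists>l' D'. s = (num l', D') \<and> valid l' \<and> walk\<^sup>*\<^sup>* (l, locs_of D) (l', locs_of D')"
  using assms(1)
proof (induction rule: rtranclp_induct)
  case base
  show ?case using assms(2) by blast
next
  case (step s s')
  then obtain l' D' where s: "s = (num l', D')" "valid l'" "walk\<^sup>*\<^sup>* (l, locs_of D) (l', locs_of D')"
    by blast
  then obtain l'' D'' where "s' = (num l'', D'')" "valid l''" "walk (l', locs_of D') (l'', locs_of D'')"
    using walk_of_level_step step.hyps(2) by blast
  then show ?case using s(3) by (blast intro: rtranclp.rtrancl_into_rtrancl)
qed

lemma level_steps_of_walk:
  assumes "walk\<^sup>*\<^sup>* (l, A) s" "A \<subseteq> Collect valid" "valid l"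
  shows "(level_step (game cfg))\<^sup>*\<^sup>* (num l, num ` A) (num (fst s), num ` snd s) \<and>
    snd s \<subseteq> Collect valid \<and> valid (fst s)"
  using assms(1)
proof (induction rule: rtranclp_induct)
  case base
  then show ?case using assms by simp
next
  case (step s s')
  then show ?case using level_step_of_walk[of "fst s" "snd s" "fst s'" "snd s'" cfg]
    by (auto intro: rtranclp.rtrancl_into_rtrancl)
qed

lemma exit_reachable_game:
  assumes "\<And>i. i < T + 2 \<Longrightarrow> cfg i \<in> set G"
  shows "exit_reachable (game cfg) \<longleftrightarrow> (\<exists>D. walk\<^sup>*\<^sup>* (Hub, door_state cfg) (Exit, D))"
proof -
  have ini: "{d. (d, True) \<in> set (doors (game cfg))} = num ` door_state cfg"
    using assms by (rule initially_open)
  have dv: "door_state cfg \<subseteq> Collect valid"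
    using assms by (rule door_state_valid)
  have reach: "exit_reachable (game cfg) \<longleftrightarrow>
      (\<exists>D. (level_step (game cfg))\<^sup>*\<^sup>* (num Hub, num ` door_state cfg) (num Exit, D))"
    unfolding exit_reachable_def ini game_ends ..
  have locs: "locs_of (num ` door_state cfg) = door_state cfg"
    using image_num_iff[OF _ dv] dv unfolding locs_of_def by blast
  have "\<exists>D'. walk\<^sup>*\<^sup>* (Hub, door_state cfg) (Exit, D')"
    if D: "(level_step (game cfg))\<^sup>*\<^sup>* (num Hub, num ` door_state cfg) (num Exit, D)" for D
  proof -
    obtain l D' where l: "num Exit = num l" "valid l" "walk\<^sup>*\<^sup>* (Hub, locs_of (num ` door_state cfg)) (l, D')"
      using walk_of_level_steps[OF D] by auto
    then have "Exit = l" using num_inj[OF _ l(2) l(1)] by simp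
    then show ?thesis using l(3) locs by metis
  qed
  moreover have "(level_step (game cfg))\<^sup>*\<^sup>* (num Hub, num ` door_state cfg) (num Exit, num ` D)"
    if "walk\<^sup>*\<^sup>* (Hub, door_state cfg) (Exit, D)" for D
    using level_steps_of_walk[OF that dv, of cfg] by simp
  ultimately show ?thesis unfolding reach by blast
qed

end

section \<open>Turing machines as cell systems\<close>

text \<open>\<open>Send w q d\<close> is a cell that already holds the newly written symbol
  \<open>w\<close> and passes the new state \<open>q\<close> on in direction \<open>d\<close>.
  \<open>Recv s q d\<close> is the neighbour that has taken the state over and still keeps its own
  symbol \<open>s\<close>.\<close>

datatype cell = Plain nat | Head nat nat | Send nat nat bool | Recv nat nat bool

definition trans :: "tm \<Rightarrow> nat \<Rightarrow> nat \<Rightarrow> nat \<times> nat \<times> int" where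
  "trans M q s = (case delta M q [s] of (q', as) \<Rightarrow> (q', hd as))"

definition fired :: "tm \<Rightarrow> nat \<Rightarrow> nat \<Rightarrow> cell" where
  "fired M q s = (case trans M q s of (q', w, d) \<Rightarrow> if d = 0 then Head q' w else Send w q' (d = 1))"

text \<open>Every rule must test a neighbour; \<open>fire\<close> uses the right one, which is plain
  whenever the head is settled, and accepts any symbol there. In the handshake the sender is cleared
  only after the state has been taken over, and the head settles only after the sender has been
  cleared.\<close>

inductive cell_rule :: "tm \<Rightarrow> cell rule \<Rightarrow> bool" for M where
  fire: "q < num_states M \<Longrightarrow> q \<notin> {1, 2} \<Longrightarrow> s < num_syms M \<Longrightarrow> b < num_syms M \<Longrightarrow>
    fired M q s \<noteq> Head q s \<Longrightarrow> cell_rule M (Rule (Head q s) False (Plain b) (fired M q s))"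
| receive: "q < num_states M \<Longrightarrow> s < num_syms M \<Longrightarrow> w < num_syms M \<Longrightarrow>
    cell_rule M (Rule (Plain s) d (Send w q d) (Recv s q d))"
| release: "q < num_states M \<Longrightarrow> s < num_syms M \<Longrightarrow> w < num_syms M \<Longrightarrow>
    cell_rule M (Rule (Send w q d) (\<not> d) (Recv s q d) (Plain w))"
| settle: "q < num_states M \<Longrightarrow> s < num_syms M \<Longrightarrow> w < num_syms M \<Longrightarrow>
    cell_rule M (Rule (Recv s q d) d (Plain w) (Head q s))"

definition cells :: "tm \<Rightarrow> cell set" where
  "cells M = Plain ` {..<num_syms M} \<union> (\<lambda>(q, s). Head q s) ` ({..<num_states M} \<times> {..<num_syms M}) \<union>
     (\<lambda>(s, q, d). Send s q d) ` ({..<num_syms M} \<times> {..<num_states M} \<times> UNIV) \<union>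
     (\<lambda>(s, q, d). Recv s q d) ` ({..<num_syms M} \<times> {..<num_states M} \<times> UNIV)"

lemma finite_cells: "finite (cells M)"
  by (simp add: cells_def)

lemma cells_simps [simp]:
  "Plain s \<in> cells M \<longleftrightarrow> s < num_syms M"
  "Head q s \<in> cells M \<longleftrightarrow> q < num_states M \<and> s < num_syms M"
  "Send s q d \<in> cells M \<longleftrightarrow> q < num_states M \<and> s < num_syms M"
  "Recv s q d \<in> cells M \<longleftrightarrow> q < num_states M \<and> s < num_syms M"
  by (auto simp: cells_def image_iff)

lemma trans_bounds:
  assumes "wf_tm M" "num_tapes M = 1" "q < num_states M" "s < num_syms M" "trans M q s = (q', w, d)"
  shows "q' < num_states M" "w < num_syms M" "d \<in> {-1, 0, 1}" "delta M q [s] = (q', [(w, d)])"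
proof -
  obtain as where as: "delta M q [s] = (q', as)" "hd as = (w, d)"
    using assms(5) by (cases "delta M q [s]") (auto simp: trans_def)
  have "case delta M q [s] of (q', as) \<Rightarrow> q' < num_states M \<and> length as = num_tapes M \<and>
      (\<forall>(w, d)\<in>set as. w < num_syms M \<and> d \<in> {-1, 0, 1})"
    using assms(1-4) unfolding wf_tm_def by simp
  then have *: "q' < num_states M" "length as = 1" "\<forall>(w, d)\<in>set as. w < num_syms M \<and> d \<in> {-1, 0, 1}"
    using as assms(2) by auto
  then obtain a where "as = [a]" by (cases as) auto
  then show "q' < num_states M" "w < num_syms M" "d \<in> {-1, 0, 1}" "delta M q [s] = (q', [(w, d)])"
    using * as by auto
qed

lemma fired_in_cells:
  assumes "wf_tm M" "num_tapes M = 1" "q < num_states M" "s < num_syms M"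
  shows "fired M q s \<in> cells M"
proof -
  obtain q' w d where "trans M q s = (q', w, d)" by (metis prod_cases3)
  then show ?thesis using trans_bounds[OF assms] by (simp add: fired_def)
qed

lemma cell_rule_in_cells:
  assumes "wf_tm M" "num_tapes M = 1" "cell_rule M r"
  shows "src r \<in> cells M \<and> nb r \<in> cells M \<and> tgt r \<in> cells M \<and> src r \<noteq> tgt r"
  using assms(3) by cases (use fired_in_cells[OF assms(1,2)] in auto)

lemma finite_cell_rules:
  assumes "wf_tm M" "num_tapes M = 1"
  shows "finite {r. cell_rule M r}"
proof (rule finite_subset)
  show "{r. cell_rule M r} \<subseteq>
      (\<lambda>(a, d, b, a'). Rule a d b a') ` (cells M \<times> UNIV \<times> cells M \<times> cells M)"
  proof
    fix r assume "r \<in> {r. cell_rule M r}"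
    then show "r \<in> (\<lambda>(a, d, b, a'). Rule a d b a') ` (cells M \<times> UNIV \<times> cells M \<times> cells M)"
      using cell_rule_in_cells[OF assms, of r]
      by (intro image_eqI[of _ _ "(src r, dir r, nb r, tgt r)"]) auto
  qed
qed (simp add: finite_cells)

text \<open>
  A move of the head from \<open>p\<close> to the neighbouring cell in direction \<open>d\<close> takes four steps, each
  changing one cell.
\<close>

definition settled :: "(nat \<Rightarrow> nat) \<Rightarrow> nat \<Rightarrow> nat \<Rightarrow> nat \<Rightarrow> cell" where
  "settled s q p i = (if i = p then Head q (s i) else Plain (s i))"

definition sending :: "(nat \<Rightarrow> nat) \<Rightarrow> nat \<Rightarrow> nat \<Rightarrow> bool \<Rightarrow> nat \<Rightarrow> cell" where
  "sending s q p d i = (if i = p then Send (s i) q d else Plain (s i))"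

definition received :: "(nat \<Rightarrow> nat) \<Rightarrow> nat \<Rightarrow> nat \<Rightarrow> bool \<Rightarrow> nat \<Rightarrow> cell" where
  "received s q p d i =
     (if i = p then Send (s i) q d else if i = nbr d p then Recv (s i) q d else Plain (s i))"

definition released :: "(nat \<Rightarrow> nat) \<Rightarrow> nat \<Rightarrow> nat \<Rightarrow> bool \<Rightarrow> nat \<Rightarrow> cell" where
  "released s q p d i = (if i = nbr d p then Recv (s i) q d else Plain (s i))"

lemma nbr_flip: "1 \<le> j \<Longrightarrow> 1 \<le> i \<Longrightarrow> nbr (\<not> d) j = i \<longleftrightarrow> j = nbr d i"
  by (auto simp: nbr_def)

lemma cell_eq_simps:
  "settled s q p i = Head q' a \<longleftrightarrow> i = p \<and> q' = q \<and> a = s i"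
  "settled s q p i = Plain a \<longleftrightarrow> i \<noteq> p \<and> a = s i"
  "settled s q p i \<noteq> Send w q' d'" "settled s q p i \<noteq> Recv w q' d'"
  "sending s q p d i = Send w q' d' \<longleftrightarrow> i = p \<and> w = s i \<and> q' = q \<and> d' = d"
  "sending s q p d i = Plain a \<longleftrightarrow> i \<noteq> p \<and> a = s i"
  "sending s q p d i \<noteq> Head q' w" "sending s q p d i \<noteq> Recv w q' d'"
  "received s q p d i = Send w q' d' \<longleftrightarrow> i = p \<and> w = s i \<and> q' = q \<and> d' = d"
  "received s q p d i = Recv w q' d' \<longleftrightarrow> i \<noteq> p \<and> i = nbr d p \<and> w = s i \<and> q' = q \<and> d' = d"
  "received s q p d i = Plain a \<longleftrightarrow> i \<noteq> p \<and> i \<noteq> nbr d p \<and> a = s i"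
  "received s q p d i \<noteq> Head q' w"
  "released s q p d i \<noteq> Send w q' d'" "released s q p d i \<noteq> Head q' w"
  "released s q p d i = Recv w q' d' \<longleftrightarrow> i = nbr d p \<and> w = s i \<and> q' = q \<and> d' = d"
  "released s q p d i = Plain a \<longleftrightarrow> i \<noteq> nbr d p \<and> a = s i"
  by (auto simp: settled_def sending_def received_def released_def)

lemma cell_updates:
  "nbr d p \<noteq> p \<Longrightarrow> (sending s q p d)(nbr d p := Recv (s (nbr d p)) q d) = received s q p d"
  "nbr d p \<noteq> p \<Longrightarrow> (received s q p d)(p := Plain (s p)) = released s q p d"
  "(released s q p d)(nbr d p := Head q (s (nbr d p))) = settled s q (nbr d p)"
  by (auto simp: settled_def sending_def received_def released_def)

text \<open>\<open>c\<close> is the cell of the tape origin and \<open>B\<close> bounds the head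
  displacement. The margins keep the head between cells \<open>3\<close> and \<open>T - 2\<close>,
  so that all cells tested or changed in the simulation are inner cells.\<close>

locale tm_cells = cell_system G Rs "\<lambda>g. \<exists>s. g = Head 1 s" T
  for G :: "cell list" and Rs T +
  fixes M :: tm and x :: "bool list" and B c :: nat
  assumes wf: "wf_tm M" and single: "num_tapes M = 1"
    and G: "set G = cells M" and Rs: "set Rs = {r. cell_rule M r}"
    and space: "\<And>t. \<forall>(_, h)\<in>set (snd (tm_run M x t)). \<bar>h\<bar> \<le> int B"
    and margins: "B + 3 \<le> c" "c + B + 2 \<le> T"
begin

lemma cell_step_cases:
  assumes "cell_step cfg cfg'"
  obtains j r where "1 \<le> j" "cell_rule M r" "cfg j = nb r" "cfg (acted j r) = src r"
    "cfg' = cfg(acted j r := tgt r)"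
  using assms unfolding cell_step_def Rs by auto

lemma cell_step_settled:
  assumes "cell_step (settled s q p) cfg'"
  shows "q \<notin> {1, 2} \<and> cfg' = (settled s q p)(p := fired M q (s p))"
  using assms
proof (cases rule: cell_step_cases)
  case (1 j r)
  from 1(2) show ?thesis
    by cases (use 1 in \<open>auto simp: cell_eq_simps\<close>)
qed

lemma cell_step_sending:
  assumes "cell_step (sending s q p d) cfg'"
  shows "cfg' = received s q p d"
  using assms
proof (cases rule: cell_step_cases)
  case (1 j r)
  from 1(2) show ?thesis
    by cases (use 1 nbr_neq[OF 1(1)] in \<open>auto simp: cell_eq_simps cell_updates\<close>)
qed

lemma cell_step_received:
  assumes "cell_step (received s q p d) cfg'" "1 \<le> p"
  shows "cfg' = released s q p d"
  using assms(1)
proof (cases rule: cell_step_cases)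
  case (1 j r)
  note neq = nbr_neq[OF assms(2)]
  from 1(2) show ?thesis
  proof cases
    case (release q' s' w d')
    have e: "nbr (\<not> d) j = p" "w = s p" "d' = d"
      using 1 release by (auto simp: cell_eq_simps)
    show ?thesis using 1(5) release(1) cell_updates(2)[OF neq] by (simp add: e)
  next
    \<comment> \<open>The receiver may also have a plain neighbour on its far side. The direction in
      the rule forces the tested cell to be the sender, which is not plain yet.\<close>
    case (settle q' s' w d')
    then have "nbr d j = nbr d p" "j \<noteq> p" using 1 by (auto simp: cell_eq_simps)
    then show ?thesis using nbr_inj[OF 1(1) assms(2)] by blast
  qed (use 1 in \<open>auto simp: cell_eq_simps\<close>)
qed

lemma cell_step_released:
  assumes "cell_step (released s q p d) cfg'"
  shows "cfg' = settled s q (nbr d p)"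
  using assms
proof (cases rule: cell_step_cases)
  case (1 j r)
  from 1(2) show ?thesis
  proof cases
    case (settle q' s' w d')
    have e: "nbr d j = nbr d p" "s' = s (nbr d j)" "q' = q" "d' = d"
      using 1 settle by (auto simp: cell_eq_simps)
    show ?thesis using 1(5) settle(1) cell_updates(3)[of s q p d] by (simp add: e)
  qed (use 1 in \<open>auto simp: cell_eq_simps\<close>)
qed

text \<open>For \<open>fire\<close>, \<open>release\<close> and \<open>settle\<close> the target is
  a function of the source. Only \<open>receive\<close> takes it from the tested cell, so agreement
  among all senders is enough.\<close>

lemma conflict_freeI:
  assumes "\<And>i j w w' q q' d d'. cfg i = Send w q d \<Longrightarrow> cfg j = Send w' q' d' \<Longrightarrow> q = q' \<and> d = d'"
  shows "conflict_free cfg"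
  unfolding conflict_free_def
proof (intro ballI impI, elim conjE)
  fix j j' r r'
  assume "r \<in> set Rs" "r' \<in> set Rs" and eq: "src r = src r'" "cfg j = nb r" "cfg j' = nb r'"
  then have r: "cell_rule M r" "cell_rule M r'" by (auto simp: Rs)
  from r(1) show "tgt r = tgt r'"
  proof cases
    case (receive q s w d)
    from r(2) show ?thesis
    proof cases
      case (receive q' s' w' d')
      then show ?thesis using \<open>r = _\<close> eq assms[of j w q d j' w' q' d'] by auto
    qed (use receive eq in auto)
  qed (use r(2) eq in \<open>auto elim!: cell_rule.cases\<close>)
qed

text \<open>The tape is shifted by \<open>c\<close>, so that positions become natural
  numbers.\<close>

definition conf :: "nat \<Rightarrow> nat \<times> (nat \<Rightarrow> nat) \<times> nat" where
  "conf t = (case tm_run M x t of (q, ts) \<Rightarrow>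
     (q, (\<lambda>i. fst (hd ts) (int i - int c)), nat (int c + snd (hd ts))))"

lemma run_single:
  "\<exists>q f h. tm_run M x t = (q, [(f, h)]) \<and> q < num_states M \<and> (\<forall>i. f i < num_syms M)"
proof (induction t)
  case 0
  have "3 \<le> num_syms M" "3 \<le> num_states M" using wf by (auto simp: wf_tm_def)
  then show ?case by (auto simp: tm_run_def tm_init_def single tape_of_def)
next
  case (Suc t)
  then obtain q f h where run: "tm_run M x t = (q, [(f, h)])" "q < num_states M" "\<forall>i. f i < num_syms M"
    by blast
  obtain q' w d where tr: "trans M q (f h) = (q', w, d)" by (metis prod_cases3)
  note b = trans_bounds[OF wf single run(2) _ tr]
  have "tm_run M x (Suc t) = tm_step M (q, [(f, h)])" using run by (simp add: tm_run_def)
  then show ?case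
    using run b by (cases "halted (q, [(f, h)])") (auto simp: tm_step_def)
qed

lemma conf_step:
  assumes "conf t = (q, s, p)"
  shows "q < num_states M" "s i < num_syms M" "3 \<le> p" "p + 2 \<le> T"
    "q \<in> {1, 2} \<Longrightarrow> conf (Suc t) = (q, s, p)"
    "q \<notin> {1, 2} \<Longrightarrow> trans M q (s p) = (q', w, d) \<Longrightarrow>
       conf (Suc t) = (q', s(p := w), if d = 0 then p else nbr (d = 1) p) \<and> d \<in> {-1, 0, 1} \<and>
       q' < num_states M \<and> w < num_syms M"
proof -
  obtain f h where run: "tm_run M x t = (q, [(f, h)])" and q: "q < num_states M"
    and f: "\<forall>i. f i < num_syms M" and s: "s = (\<lambda>i. f (int i - int c))" and p: "p = nat (int c + h)"
    using run_single[of t] assms by (auto simp: conf_def)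
  have h: "\<bar>h\<bar> \<le> int B" using space[of t] run by simp
  show "q < num_states M" "s i < num_syms M" by (use q f s in auto)
  show p3: "3 \<le> p" and "p + 2 \<le> T" using h margins p by linarith+
  have step: "tm_run M x (Suc t) = tm_step M (q, [(f, h)])" using run by (simp add: tm_run_def)
  show "conf (Suc t) = (q, s, p)" if "q \<in> {1, 2}"
    using that step s p by (simp add: conf_def tm_step_def halted_def)
  assume nh: "q \<notin> {1, 2}" and tr: "trans M q (s p) = (q', w, d)"
  have p': "int p = int c + h" using p p3 by linarith
  have sp: "s p = f h" using p' s by simp
  note b = trans_bounds[OF wf single q _ tr[unfolded sp]]
  have "tm_run M x (Suc t) = (q', [(f(h := w), h + d)])"
    using nh step b(4) f by (simp add: tm_step_def halted_def)
  then have "conf (Suc t) = (q', (\<lambda>i. (f(h := w)) (int i - int c)), nat (int c + (h + d)))"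
    by (simp add: conf_def)
  moreover have "(\<lambda>i. (f(h := w)) (int i - int c)) = s(p := w)"
    using p' s by (auto simp: fun_eq_iff)
  moreover have "nat (int c + (h + d)) = (if d = 0 then p else nbr (d = 1) p)"
    using b(3) f p' p3 by (auto simp: nbr_def)
  ultimately show "conf (Suc t) = (q', s(p := w), if d = 0 then p else nbr (d = 1) p) \<and>
      d \<in> {-1, 0, 1} \<and> q' < num_states M \<and> w < num_syms M"
    using b f by simp
qed

text \<open>While the head is on its way, the row already counts as the configuration after the
  move, with \<open>p\<close> as the destination.\<close>

definition phase :: "(nat \<Rightarrow> cell) \<Rightarrow> bool" where
  "phase cfg \<longleftrightarrow> (\<exists>t q s p. conf t = (q, s, p) \<and> (cfg = settled s q p \<or>
     (\<exists>p0 d. 1 \<le> p0 \<and> nbr d p0 = p \<and>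
       cfg \<in> {sending s q p0 d, received s q p0 d, released s q p0 d})))"

lemma phase_conflict_free: "phase cfg \<Longrightarrow> conflict_free cfg"
  unfolding phase_def by (intro conflict_freeI) (auto simp: cell_eq_simps)

lemma phase_accepts:
  assumes "phase cfg" "cfg i = Head 1 s"
  shows "\<exists>t. fst (tm_run M x t) = 1"
proof -
  obtain t q s' p where "conf t = (q, s', p)" "q = 1"
    using assms unfolding phase_def by (auto simp: cell_eq_simps)
  then have "fst (tm_run M x t) = 1" by (cases "tm_run M x t") (simp add: conf_def)
  then show ?thesis by blast
qed

lemma settled_fired:
  assumes "trans M q (s p) = (q', w, d)" "d \<in> {-1, 0, 1}"
  shows "(settled s q p)(p := fired M q (s p)) =
    (if d = 0 then settled (s(p := w)) q' p else sending (s(p := w)) q' p (d = 1))"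
  using assms by (auto simp: fired_def settled_def sending_def fun_eq_iff)

text \<open>Firing passes from \<open>t\<close> to \<open>Suc t\<close>; the three changes of the
  handshake stay at the same time.\<close>

lemma phase_cell_step:
  assumes "phase cfg" "cell_step cfg cfg'"
  shows "phase cfg'"
proof -
  obtain t q s p where conf: "conf t = (q, s, p)"
    and alt: "cfg = settled s q p \<or> (\<exists>p0 d. 1 \<le> p0 \<and> nbr d p0 = p \<and>
       cfg \<in> {sending s q p0 d, received s q p0 d, released s q p0 d})"
    using assms(1) unfolding phase_def by blast
  from alt show ?thesis
  proof (elim disjE exE conjE)
    assume cfg: "cfg = settled s q p"
    obtain q' w d where tr: "trans M q (s p) = (q', w, d)" by (metis prod_cases3)
    have q: "q \<notin> {1, 2}" and cfg': "cfg' = (settled s q p)(p := fired M q (s p))"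
      using cell_step_settled assms(2) cfg by auto
    note st = conf_step(6)[OF conf q tr]
    have "1 \<le> p" using conf_step(3)[OF conf] by simp
    show ?thesis
    proof (cases "d = 0")
      case True
      then have "conf (Suc t) = (q', s(p := w), p)" "cfg' = settled (s(p := w)) q' p"
        using st settled_fired[of q s p q' w d, OF tr] cfg' by simp_all
      then show ?thesis unfolding phase_def by blast
    next
      case False
      then have "conf (Suc t) = (q', s(p := w), nbr (d = 1) p)" "cfg' = sending (s(p := w)) q' p (d = 1)"
        using st settled_fired[of q s p q' w d, OF tr] cfg' by simp_all
      then show ?thesis using \<open>1 \<le> p\<close> unfolding phase_def by blast
    qed
  next
    fix p0 d
    assume p: "1 \<le> p0" "nbr d p0 = p" "cfg \<in> {sending s q p0 d, received s q p0 d, released s q p0 d}"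
    then have "cfg' = received s q p0 d \<or> cfg' = released s q p0 d \<or> cfg' = settled s q p"
      using assms(2) cell_step_sending cell_step_received[OF _ p(1)] cell_step_released by blast
    then show ?thesis using conf p(1,2) unfolding phase_def by blast
  qed
qed

text \<open>
  The run starts with a head arriving from the left at the first input cell, so that no initial
  cell depends both on the head and on an input bit.
\<close>

definition start :: "nat \<Rightarrow> cell" where
  "start = sending (\<lambda>i. tape_of x (int i - int c)) 0 (c - 1) True"

lemma conf_0: "conf 0 = (0, \<lambda>i. tape_of x (int i - int c), c)"
  by (simp add: conf_def tm_run_def tm_init_def single)

lemma phase_start: "phase start"
  unfolding phase_def start_def
  using conf_0 margins by (intro exI[of _ 0]) (auto simp: nbr_def intro!: exI[of _ "c - 1"] exI[of _ True])

lemma phase_reachable: "cell_step\<^sup>*\<^sup>* start cfg \<Longrightarrow> phase cfg"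
  by (induction rule: rtranclp_induct) (auto intro: phase_start phase_cell_step)

lemma walk_rule:
  assumes "cell_rule M r" "j \<in> {1..T}" "acted j r \<in> {1..T}" "cfg j = nb r" "cfg (acted j r) = src r"
    and "cfg' = cfg(acted j r := tgt r)"
  shows "walk\<^sup>*\<^sup>* (Hub, door_state cfg) (Hub, door_state cfg')"
  unfolding assms(6) using assms by (intro walk_cell_step) (auto simp: Rs)

lemma walk_send:
  assumes "q < num_states M" "\<And>i. s i < num_syms M" "p \<in> {1..T}" "nbr d p \<in> {1..T}"
  shows "walk\<^sup>*\<^sup>* (Hub, door_state (sending s q p d)) (Hub, door_state (settled s q (nbr d p)))"
proof -
  let ?p' = "nbr d p"
  have neq: "?p' \<noteq> p" using assms(3) nbr_neq by auto
  have flip: "nbr (\<not> d) ?p' = p" using assms(3,4) nbr_flip[of ?p' p d] by auto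
  have "walk\<^sup>*\<^sup>* (Hub, door_state (sending s q p d)) (Hub, door_state (received s q p d))"
    by (rule walk_rule[OF receive[of q M "s ?p'" "s p" d], of p])
      (use assms neq cell_updates(1)[OF neq] in \<open>simp_all add: cell_eq_simps\<close>)
  also have "walk\<^sup>*\<^sup>* (Hub, door_state (received s q p d)) (Hub, door_state (released s q p d))"
    by (rule walk_rule[OF release[of q M "s ?p'" "s p" d], of ?p'])
      (use assms neq flip cell_updates(2)[OF neq] in \<open>simp_all add: cell_eq_simps\<close>)
  also have "walk\<^sup>*\<^sup>* (Hub, door_state (released s q p d)) (Hub, door_state (settled s q ?p'))"
    by (rule walk_rule[OF settle[of q M "s ?p'" "s p" d], of p])
      (use assms neq cell_updates(3)[of s q p d] in \<open>simp_all add: cell_eq_simps\<close>)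
  finally show ?thesis .
qed

lemma walk_run:
  assumes "conf t = (q, s, p)"
  shows "walk\<^sup>*\<^sup>* (Hub, door_state start) (Hub, door_state (settled s q p))"
  using assms
proof (induction t arbitrary: q s p)
  case 0
  then have eq: "q = 0" "s = (\<lambda>i. tape_of x (int i - int c))" "p = c" using conf_0 by auto
  have "nbr True (c - 1) = c" using margins by (simp add: nbr_def)
  moreover have "c - 1 \<in> {1..T}" "c \<in> {1..T}" using margins by auto
  ultimately show ?case
    using walk_send[of q s "c - 1" True] conf_step(1,2)[OF 0]
    unfolding eq start_def by simp
next
  case (Suc t)
  obtain q0 s0 p0 where conf: "conf t = (q0, s0, p0)" by (metis prod_cases3)
  note IH = Suc.IH[OF conf]
  show ?case
  proof (cases "q0 \<in> {1, 2}")
    case True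
    then show ?thesis using IH conf_step(5)[OF conf] Suc.prems by simp
  next
    case False
    obtain q' w d where tr: "trans M q0 (s0 p0) = (q', w, d)" by (metis prod_cases3)
    have st: "conf (Suc t) = (q', s0(p0 := w), if d = 0 then p0 else nbr (d = 1) p0)"
      and d: "d \<in> {-1, 0, 1}" using conf_step(6)[OF conf False tr] by auto
    have p0: "3 \<le> p0" "p0 + 2 \<le> T" using conf_step(3,4)[OF conf] by auto
    have eq: "q = q'" "s = s0(p0 := w)" "p = (if d = 0 then p0 else nbr (d = 1) p0)"
      using st Suc.prems by auto
    let ?cfg = "(settled s0 q0 p0)(p0 := fired M q0 (s0 p0))"
    have 1: "walk\<^sup>*\<^sup>* (Hub, door_state (settled s0 q0 p0)) (Hub, door_state ?cfg)"
    proof (cases "fired M q0 (s0 p0) = Head q0 (s0 p0)")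
      \<comment> \<open>A machine step that changes nothing has no rule, since the source and target
        of a rule differ; the row stays as it is.\<close>
      case True
      then have "?cfg = settled s0 q0 p0" by (auto simp: settled_def fun_eq_iff)
      then show ?thesis by simp
    next
      case neq: False
      \<comment> \<open>The tested cell is the plain right neighbour \<open>Suc p0\<close>.\<close>
      have "nbr False (Suc p0) = p0" by (simp add: nbr_def)
      then show ?thesis
        using p0 conf_step(1,2)[OF conf] neq False
        by (intro walk_rule[OF fire[of q0 M "s0 p0" "s0 (Suc p0)"], of "Suc p0"])
          (auto simp: settled_def)
    qed
    have 2: "walk\<^sup>*\<^sup>* (Hub, door_state ?cfg) (Hub, door_state (settled s q p))"
    proof (cases "d = 0")
      case True
      then show ?thesis using settled_fired[of q0 s0 p0 q' w d, OF tr d] eq by simp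
    next
      case False
      have "nbr (d = 1) p0 \<in> {1..T}" using p0 by (auto simp: nbr_def)
      moreover have "q < num_states M" "\<And>i. s i < num_syms M" "p0 \<in> {1..T}"
        using conf_step(1,2)[OF Suc.prems] p0 by auto
      ultimately have "walk\<^sup>*\<^sup>* (Hub, door_state (sending s q p0 (d = 1)))
          (Hub, door_state (settled s q (nbr (d = 1) p0)))" by (intro walk_send)
      then show ?thesis
        using settled_fired[of q0 s0 p0 q' w d, OF tr d] eq False by simp
    qed
    show ?thesis by (rule rtranclp_trans[OF IH rtranclp_trans[OF 1 2]])
  qed
qed

theorem walk_exit_iff:
  "(\<exists>D. walk\<^sup>*\<^sup>* (Hub, door_state start) (Exit, D)) \<longleftrightarrow> (\<exists>t. fst (tm_run M x t) = 1)"
proof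
  assume "\<exists>D. walk\<^sup>*\<^sup>* (Hub, door_state start) (Exit, D)"
  then obtain D where "walk\<^sup>*\<^sup>* (Hub, door_state start) (Exit, D)" ..
  from walk_sound[OF _ this] obtain cfg i s where "cell_step\<^sup>*\<^sup>* start cfg" "cfg i = Head 1 s"
    using phase_conflict_free phase_reachable by (auto simp: invariant_def)
  then show "\<exists>t. fst (tm_run M x t) = 1" using phase_accepts phase_reachable by blast
next
  assume "\<exists>t. fst (tm_run M x t) = 1"
  then obtain t where t: "fst (tm_run M x t) = 1" ..
  then obtain s p where conf: "conf t = (1, s, p)" by (cases "tm_run M x t") (simp add: conf_def)
  have "settled s 1 p p = Head 1 (s p)" by (simp add: settled_def)
  then have "walk\<^sup>*\<^sup>* (Hub, door_state (settled s 1 p)) (Exit, door_state (settled s 1 p))"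
    using conf_step(1-4)[OF conf] by (intro walk_exit[of p]) (auto simp: G)
  then show "\<exists>D. walk\<^sup>*\<^sup>* (Hub, door_state start) (Exit, D)"
    using walk_run[OF conf] rtranclp_trans by fast
qed

lemma start_in_cells: "start i \<in> set G"
proof -
  have "3 \<le> num_syms M" "3 \<le> num_states M" using wf by (auto simp: wf_tm_def)
  then show ?thesis by (simp add: start_def sending_def G tape_of_def)
qed

end

section \<open>The reduction\<close>

text \<open>Translating one gadget yields the gadgets of all cells. The model for edges and buttons
  sits at cell 1, where a left neighbour exists, and the one for doors at cell 0.\<close>

fun shift :: "nat \<Rightarrow> 'g loc \<Rightarrow> 'g loc" where
  "shift i (At j k) = At (i + j) k"
| "shift i l = l"

lemma nbr_Suc: "nbr d (Suc i) = i + nbr d (Suc 0)"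
  by (simp add: nbr_def)

lemma rule_edges_shift:
  "rule_edges (Suc i) = (\<lambda>r. map (map_prod (shift i) (shift i)) (rule_edges (Suc 0) r))"
  by (simp add: rule_edges_def nbr_Suc[of _ i] fun_eq_iff)

context cell_system
begin

lemma chain_shift: "chain (Suc i) g = map (shift i) (chain (Suc 0) g)"
  by (simp add: chain_def)

lemma edges_at_shift: "edges_at (Suc i) = map (map_prod (shift i) (shift i)) (edges_at 1)"
proof -
  have "zip (map (shift i) xs) (tl (map (shift i) xs)) = map (map_prod (shift i) (shift i)) (zip xs (tl xs))"
    for xs :: "'g loc list"
    by (simp add: map_tl[symmetric] zip_map_map map_prod_def)
  then show ?thesis
    unfolding edges_at_def
    by (simp add: chain_shift[of i] rule_edges_shift[of i] map_concat o_def)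
qed

lemma buttons_at_shift:
  "buttons_at (Suc i) = map (map_prod (shift i) (map (apfst (shift i)))) (buttons_at 1)"
  by (simp add: buttons_at_def map_concat o_def nbr_Suc[of _ i])

lemma doors_at_shift: "doors_at i g = map (apfst (shift i)) (doors_at 0 g)"
  by (simp add: doors_at_def)

end

section \<open>The encoding of the level as expanded tokens\<close>

lemma expand_append: "expand m i (ts @ us) = expand m i ts @ expand m i us"
  by (simp add: expand_def)

lemma expand_concat: "expand m i (concat tss) = concat (map (expand m i) tss)"
  by (induction tss) (simp_all add: expand_append, simp add: expand_def)

lemma expand_simps:
  "expand m i [] = []"
  "expand m i (Bit b # ts) = b # expand m i ts"
  "expand m i (Rep # ts) = replicate (i * m) True @ expand m i ts"
  "expand m i (replicate j (Bit b)) = replicate j b"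
  by (induction j) (simp_all add: expand_def)

context numbered_cell_system
begin

fun loc_toks :: "'a loc \<Rightarrow> tok list" where
  "loc_toks Hub = [Bit False]"
| "loc_toks Exit = [Bit True, Bit False]"
| "loc_toks (At j k) = Rep # replicate (2 + j * m + e k) (Bit True) @ [Bit False]"

lemma expand_loc_toks: "expand m i (loc_toks l) = enc_nat (num (shift i l))"
proof (cases l)
  case (At j k)
  have "num (shift i l) = i * m + (2 + j * m + e k)" using At by (simp add: algebra_simps)
  then show ?thesis
    by (simp only: At loc_toks.simps expand_simps expand_append enc_nat_def replicate_add append_assoc)
qed (simp_all add: expand_simps enc_nat_def)

definition edge_toks :: "tok list" where
  "edge_toks = concat (map (\<lambda>(u, v). Bit True # loc_toks u @ loc_toks v) (edges_at 1))"

definition act_toks :: "('a loc \<times> bool) list \<Rightarrow> tok list" where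
  "act_toks acts = concat (map (\<lambda>(d, b). Bit True # loc_toks d @ [Bit b]) acts)"

definition door_toks :: "'a \<Rightarrow> tok list" where
  "door_toks g = act_toks (doors_at 0 g)"

definition button_toks :: "tok list" where
  "button_toks = concat (map (\<lambda>(l, acts). Bit True # loc_toks l @ act_toks acts @ [Bit False]) (buttons_at 1))"

definition size_toks :: "tok list" where
  "size_toks = Rep # replicate (2 * m + 2) (Bit True) @ [Bit False]"

lemma enc_list_concat:
  "enc_list en (map f (concat (map g is))) = concat (map (\<lambda>i. concat (map (\<lambda>y. True # en (f y)) (g i))) is) @ [False]"
  by (simp add: enc_list_def map_concat o_def) (induction "is", simp_all)

lemma expand_edge_toks:
  "expand m i edge_toks =
     concat (map (\<lambda>y. True # enc_pair enc_nat enc_nat (map_prod num num y)) (edges_at (Suc i)))"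
  by (simp add: edge_toks_def edges_at_shift[of i] expand_concat o_def case_prod_unfold expand_simps
      expand_append expand_loc_toks enc_pair_def)

lemma expand_act_toks:
  "expand m i (act_toks acts) =
     concat (map (\<lambda>y. True # enc_pair enc_nat enc_bool (apfst num y)) (map (apfst (shift i)) acts))"
  by (simp add: act_toks_def expand_concat o_def case_prod_unfold expand_simps
      expand_append expand_loc_toks enc_pair_def enc_bool_def)

lemma expand_door_toks:
  "expand m i (door_toks g) =
     concat (map (\<lambda>y. True # enc_pair enc_nat enc_bool (apfst num y)) (doors_at i g))"
  unfolding door_toks_def expand_act_toks doors_at_shift[of i g] ..

lemma expand_button_toks:
  "expand m i button_toks = concat (map (\<lambda>y. True # enc_pair enc_nat (enc_list (enc_pair enc_nat enc_bool))
     (map_prod num (map (apfst num)) y)) (buttons_at (Suc i)))"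
  by (simp add: button_toks_def buttons_at_shift[of i] expand_concat o_def case_prod_unfold expand_simps
      expand_append expand_loc_toks enc_pair_def expand_act_toks enc_list_def)

text \<open>The right-hand side has the shape of \<open>generated\<close>; the initial configuration
  enters only through the doors.\<close>

lemma enc_game:
  "enc_level (game cfg) =
     expand m T size_toks @ concat (map (\<lambda>i. expand m i edge_toks) [0..<T]) @ [False, False, True, False] @
     concat (map (\<lambda>i. expand m i (door_toks (cfg i))) [0..<T + 2]) @ [False] @
     concat (map (\<lambda>i. expand m i button_toks) [0..<T]) @ [False]"
proof -
  have up: "[1..<Suc T] = map Suc [0..<T]" by (simp only: map_Suc_upt One_nat_def)
  have size: "enc_nat ((T + 2) * m + 2) = expand m T size_toks"
  proof -
    have "(T + 2) * m + 2 = T * m + (2 * m + 2)" by (simp add: algebra_simps)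
    then show ?thesis
      by (simp only: size_toks_def expand_simps expand_append enc_nat_def replicate_add append_assoc)
  qed
  have 0: "enc_nat 0 = [False]" "enc_nat 1 = [True, False]" by (simp_all add: enc_nat_def)
  have "enc_level (game cfg) = expand m T size_toks @
     (concat (map (\<lambda>i. expand m i edge_toks) [0..<T]) @ [False]) @ [False] @ [True, False] @
     (concat (map (\<lambda>i. expand m i (door_toks (cfg i))) [0..<T + 2]) @ [False]) @
     (concat (map (\<lambda>i. expand m i button_toks) [0..<T]) @ [False])"
    unfolding enc_level_def game_def level.simps size 0 enc_list_concat up expand_edge_toks
      expand_door_toks expand_button_toks map_map o_def ..
  then show ?thesis by simp
qed

end

text \<open>Excludes that a run reaches both state 1 and state 2, so that reaching state 1 is
  equivalent to membership.\<close>

lemma tm_run_halted: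
  assumes "halted (tm_run M x t)" "t \<le> t'"
  shows "tm_run M x t' = tm_run M x t"
  using assms(2)
proof (induction t' rule: dec_induct)
  case (step k)
  then show ?case using assms(1) by (simp add: tm_run_def tm_step_def)
qed simp

theorem theorem5: "PSPACE_hard (button_game 2)"
  unfolding PSPACE_hard_def
proof
  fix A assume "A \<in> PSPACE"
  then obtain M and p :: "nat poly" where M: "wf_tm M" "num_tapes M = 1"
    and space: "\<And>x t. \<forall>(_, h)\<in>set (snd (tm_run M x t)). \<bar>h\<bar> \<le> int (poly p (length x))"
    and dec: "\<And>x. \<exists>t. fst (tm_run M x t) = (if x \<in> A then 1 else 2)"
    unfolding PSPACE_def by blast
  have accepts: "(\<exists>t. fst (tm_run M x t) = 1) \<longleftrightarrow> x \<in> A" for x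
  proof
    assume "\<exists>t. fst (tm_run M x t) = 1"
    then obtain t where t: "fst (tm_run M x t) = 1" ..
    obtain t' where t': "fst (tm_run M x t') = (if x \<in> A then 1 else 2)" using dec by blast
    have "halted (tm_run M x t)" "halted (tm_run M x t')" using t t' by (auto simp: halted_def)
    then have "tm_run M x t = tm_run M x t'" using tm_run_halted nle_le by metis
    then have "fst (tm_run M x t') = 1" using t by metis
    then show "x \<in> A" using t' by (metis one_eq_numeral_iff num.distinct(1))
  next
    assume "x \<in> A"
    then show "\<exists>t. fst (tm_run M x t) = 1" using dec by metis
  qed
  \<comment> \<open>These lists, and the numbering \<open>e\<close> below, depend only on
    \<open>M\<close>, so the token lists are constants of the generating program.\<close>
  obtain G where G: "set G = cells M" "distinct G"
    using finite_distinct_list[OF finite_cells] by blast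
  obtain Rs where Rs: "set Rs = {r. cell_rule M r}" "distinct Rs"
    using finite_distinct_list[OF finite_cell_rules[OF M]] by blast
  let ?acc = "\<lambda>g. \<exists>s. g = Head 1 s"
  have cell_sys: "cell_system G Rs"
    using G Rs cell_rule_in_cells[OF M] by unfold_locales auto
  obtain e where "bij_betw e (cell_system.kinds G Rs) {0..<card (cell_system.kinds G Rs)}"
    using ex_bij_betw_finite_nat[OF cell_system.finite_kinds[OF cell_sys]] by blast
  moreover define m where "m = card (cell_system.kinds G Rs)"
  ultimately have e: "inj_on e (cell_system.kinds G Rs)" "\<forall>k\<in>cell_system.kinds G Rs. e k < m"
    by (auto simp: bij_betw_def)
  have num_sys: "numbered_cell_system G Rs e m"
    using cell_sys e by (auto simp: numbered_cell_system_def numbered_cell_system_axioms_def)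
  \<comment> \<open>For \<open>B = poly p n\<close> this gives \<open>w = B + 3\<close>, the origin
    \<open>c = B + 5\<close> and \<open>T = 2 * B + n + 7\<close>. Both margins hold, the right one
    with equality on empty input.\<close>
  define w where "w x = poly (p + [:3:]) (length x)" for x :: "bool list"
  define T where "T x = 2 * w x + length x + 1" for x
  have tm_sys: "tm_cells G Rs (T x) M x (poly p (length x)) (w x + 2)" for x
    using cell_sys M G Rs space by (auto simp: tm_cells_def tm_cells_axioms_def T_def w_def)
  define f where "f = generated m (p + [:3:])
     (numbered_cell_system.size_toks m) (numbered_cell_system.edge_toks G Rs ?acc e m)
     (\<lambda>s. numbered_cell_system.door_toks G Rs e m (Plain s))
     (numbered_cell_system.door_toks G Rs e m (Send 0 0 True))
     (numbered_cell_system.button_toks Rs e m)"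
  have "x \<in> A \<longleftrightarrow> f x \<in> button_game 2" for x
  proof -
    interpret tm_cells G Rs "T x" M x "poly p (length x)" "w x + 2" by (rule tm_sys)
    interpret numbered_cell_system G Rs ?acc "T x" e m by (rule num_sys)
    \<comment> \<open>The sender of \<open>start\<close> is cell \<open>c - 1 = w + 1\<close>, one
      position left of the input; the tape is blank there, whence the symbol 0 in
      \<open>Send 0 0 True\<close>.\<close>
    have "cell_toks (\<lambda>s. door_toks (Plain s)) (door_toks (Send 0 0 True)) x (w x) i = door_toks (start i)" for i
      unfolding cell_toks_def start_def sending_def by (simp add: tape_of_def)
    then have f: "f x = enc_level (game start)"
      unfolding enc_game f_def generated_def Let_def w_def[symmetric] T_def[symmetric] by simp
    have "f x \<in> button_game 2 \<longleftrightarrow> exit_reachable (game start)"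
      unfolding f button_game_def using wf_game inj_enc_level by (auto dest: injD)
    also have "\<dots> \<longleftrightarrow> (\<exists>t. fst (tm_run M x t) = 1)"
      using exit_reachable_game[of start] start_in_cells walk_exit_iff by simp
    finally show ?thesis using accepts by blast
  qed
  moreover have "polytime_computable f"
    unfolding f_def by (rule polytime_computable_generated)
  ultimately show "polytime_reducible A (button_game 2)"
    unfolding polytime_reducible_def by blast
qed

end
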